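(* Let $n$ be a positive integer with $n\equiv 3\pmod 4$. Then \[ \sum_{k=0}^{n-1}[6k+1]\frac{(q;q^2)_k^2(q^2;q^4)_k(q;q^4)_k^2}{(q^2;q^2)_k^2(q^4;q^4)_k^3}q^{2k} \equiv[3n]\frac{q^{2n}(2-q^n)}{(1+q^n)^2}\frac{(q^2;q^4)_{(3n-1)/4}^2}{(q^4;q^4)_{(3n-1)/4}^2}\pmod{[n]\Phi_n(q)^4}. \]
   Context: For a complex number $x$ and integer $n\ge 0$, $(x;q)_n=\prod_{j=0}^{n-1}(1-xq^j)$ (with $(x;q)_0=1$). $[r]=(1-q^r)/(1-q)$ denotes the $q$-integer, and $\Phi_n(q)$ is the $n$-th cyclotomic polynomial in $q$. A congruence $A(q)\equiv B(q)\pmod{P(q)}$ between rational functions in $q$ whose denominators are coprime to the polynomial $P(q)$ means that $A(q)-B(q)$ is a rational function whose numerator is divisible by $P(q)$ and whose denominator is coprime to $P(q)$. *)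

theory Defs
  imports
    Complex_Main
    "HOL-Computational_Algebra.Computational_Algebra"
    "HOL-Number_Theory.Cong"
begin

text \<open>Rational functions in the indeterminate \<open>q\<close> are elements of \<^typ>\<open>complex poly fract\<close>.\<close>

definition qvar :: "complex poly fract"
  where "qvar = Fraction_Field.Fract [:0, 1:] 1"

definition qpoch :: "'a::comm_ring_1 \<Rightarrow> 'a \<Rightarrow> nat \<Rightarrow> 'a"
  where "qpoch x q n = (\<Prod>j<n. 1 - x * q ^ j)"

text \<open>
  \<open>div\<close> is the common division operation: on \<^typ>\<open>complex poly fract\<close> it is field division \<open>/\<close>,
  while on \<^typ>\<open>complex poly\<close>, with \<open>q = [:0, 1:]\<close>, it is polynomial division, which is exact here.
  The latter gives the polynomial that occurs in a modulus.
\<close>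

definition qint :: "'a::idom_divide \<Rightarrow> nat \<Rightarrow> 'a"
  where "qint q r = (1 - q ^ r) div (1 - q)"

definition cyclotomic :: "nat \<Rightarrow> complex poly"
  where "cyclotomic n = (\<Prod>k | 1 \<le> k \<and> k \<le> n \<and> coprime k n. [:- cis (2 * pi * real k / real n), 1:])"

text \<open>
  \<open>f\<close> can be written with a denominator coprime to \<open>P\<close>; equivalently, its reduced denominator is
  coprime to \<open>P\<close>.
\<close>

definition denom_coprime :: "complex poly fract \<Rightarrow> complex poly \<Rightarrow> bool"
  where "denom_coprime f P \<longleftrightarrow>
    (\<exists>a b. b \<noteq> 0 \<and> f = Fraction_Field.Fract a b \<and> coprime b P)"

text \<open>
  The congruence is meaningful only for rational functions with denominators coprime to the modulus;
  this proviso is part of the relation.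
\<close>

definition ratfun_cong :: "complex poly fract \<Rightarrow> complex poly fract \<Rightarrow> complex poly \<Rightarrow> bool"
  where "ratfun_cong A B P \<longleftrightarrow>
    denom_coprime A P \<and> denom_coprime B P \<and>
    (\<exists>a b. b \<noteq> 0 \<and> A - B = Fraction_Field.Fract a b \<and> P dvd a \<and> coprime b P)"

end

theory Submission
  imports
    Defs
    "HOL-Complex_Analysis.Complex_Analysis"
    "HOL-Library.Landau_Symbols"
begin

text \<open>
  Two pairs of factors of the summand are deformed by parameters \<open>x\<close> and \<open>y\<close>, which makes it a special
  case of the summand of the Gasper-Rahman quadratic summation; write \<open>F(X,Y)\<close> for the sum, where
  \<open>X = 2 - x - 1/x\<close> and \<open>Y = 2 - y - 1/y\<close>. The series terminates for \<open>x = q^n\<close>, where it vanishes because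
  \<open>n \<equiv> 3 (mod 4)\<close>, and for \<open>y = q^(3n)\<close>, where it has a closed form; both are proved by telescoping. Let
  \<open>X'\<close> and \<open>Y'\<close> be the values of \<open>X\<close> and \<open>Y\<close> at these points: they vanish to second order at a primitive
  \<open>n\<close>-th root of unity \<open>\<zeta>\<close>. The double difference \<open>F(0,0) - F(X',0) - F(0,Y') + F(X',Y')\<close> is
  \<open>X' Y'\<close> times a function which vanishes at \<open>\<zeta>\<close>, since \<open>F(X,Y)\<close> is identically zero for \<open>q = \<zeta>\<close>. Hence
  \<open>F(0,0)\<close> equals \<open>F(0,Y') - F(X',Y')\<close> up to order five, and this difference of closed forms agrees with
  the right-hand side up to order five. For \<open>\<zeta>\<close> of a smaller order \<open>d\<close>, the sum splits into blocks of
  length \<open>d\<close>, each of which vanishes at \<open>\<zeta>\<close>.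
\<close>

subsection \<open>Quadratic summations by telescoping\<close>

text \<open>Two parameters are needed for the order. Since the deformed sum vanishes identically at
  \<open>q = \<zeta>\<close>, comparing \<open>F(0,0)\<close> with a single value
  \<open>F(X',0)\<close> or \<open>F(0,Y')\<close> gains order two from the parameter and one from
  the cofactor, hence three in all; the product \<open>X' * Y'\<close> raises this to five. The
  exponent \<open>3 * n\<close> is forced by the closed form: termination through \<open>y\<close>
  happens at exponents \<open>4*N+1\<close>, and for \<open>n \<equiv> 3 (mod 4)\<close> the number
  \<open>3 * n\<close> has this form with \<open>N = (3*n-1)/4 < n\<close>, so that the sum over
  \<open>k < n\<close> contains the whole terminating series. The summation formulas carry
  nonvanishing conditions that fail at roots of unity. They are therefore used only for
  \<open>0 < |q| < 1\<close>, where distinct powers of \<open>q\<close> differ, and all statements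
  at \<open>\<zeta>\<close> are limits from inside the disc.\<close>

lemma qpoch_0 [simp]: "qpoch x q 0 = 1"
  by (simp add: qpoch_def)

lemma qpoch_Suc: "qpoch x q (Suc k) = qpoch x q k * (1 - x * q ^ k)"
  by (simp add: qpoch_def)

lemma qpoch_shift: "(1 - x) * qpoch (q * x) q k = qpoch x q k * (1 - x * q ^ k)"
proof (induction k)
  case (Suc k)
  have "(1 - x) * qpoch (q * x) q (Suc k) = qpoch x q k * (1 - x * q ^ k) * (1 - q * x * q ^ k)"
    by (subst Suc[symmetric]) (simp add: qpoch_Suc mult.assoc)
  then show ?case
    by (simp add: qpoch_Suc mult_ac)
qed simp

lemma qpoch_shift2:
  "(1 - x) * (1 - q * x) * qpoch (q ^ 2 * x) q k = qpoch x q k * (1 - x * q ^ k) * (1 - q * x * q ^ k)"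
  using qpoch_shift[of x q k] qpoch_shift[of "q * x" q k]
  by (simp add: power2_eq_square mult.assoc) (metis mult.assoc mult.commute)

lemma qpoch_eq_0_iff: "qpoch (x::'a::idom) q k = 0 \<longleftrightarrow> (\<exists>j<k. x * q ^ j = 1)"
  by (auto simp: qpoch_def)

text \<open>
  The next two identities are the polynomial form of telescoping certificates for the contiguous
  relations \<open>(D, G) \<rightarrow> (D q^2, G / q^2)\<close> and \<open>(b, c) \<rightarrow> (b / q^2, c q^2)\<close>, with \<open>u\<close> standing for \<open>q^k\<close>.
\<close>

lemma contiguous_identity_d:
  fixes q s E F G u :: complex
  defines "w \<equiv> E*F*G"
  shows "(E-G)*((1-q*w*u)*(1-s*u+q*u^2)*(1-F*G*u^2)*(1-E*F*u^2)*(1-q*E*G*u^2)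
    - (1-u^2)*(1-s*w*u^2+q*w^2*u^4)*(1-q*E*u)*(1-F*u)*(1-q*G*u))
   = u*(1-q*w*u^3)*((1-F*G)*(q*E^2-s*E+1)*(1-E*F*u^2)*(1-q*G*u)*(1-G*u)
      - (1-E*F)*(q*G^2-s*G+1)*(1-F*G*u^2)*(1-E*u)*(1-q*E*u))"
  unfolding w_def by algebra

lemma contiguous_identity_b:
  fixes q b c D F G u :: complex
  defines "a \<equiv> q*D*F*G"
  assumes "q*b*c = 1"
  shows "(b-c)*((1-a*u)*(1-b*u)*(1-c*u)*(1-q*F*G*u^2)*(1-q*D*G*u^2)*(1-q*D*F*u^2)
    - (1-u^2)*(1-a*q*b*u^2)*(1-a*q*c*u^2)*(1-D*u)*(1-F*u)*(1-G*u))
   = u*(1-a*u^3)*q*(b*(c-D)*(c-F)*(c-G)*(1-b*u)*(1-q*b*u)*(1-a*q*c*u^2)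
      - c*(b-D)*(b-F)*(b-G)*(1-c*u)*(1-q*c*u)*(1-a*q*b*u^2))"
  using assms(2) unfolding a_def by algebra

text \<open>The relation for \<open>C\<close> turns \<open>e * \<alpha> (q^k) * C k / q^k\<close>
  into the next value of \<open>e * \<beta> (q^k) * C k / q^k\<close>, so \<open>t k\<close> is a
  difference of consecutive values; the lower boundary value vanishes by
  \<open>\<beta> 1 = 0\<close>.\<close>

lemma gosper_sum:
  fixes q e :: "'a::field" and C t :: "nat \<Rightarrow> 'a" and \<alpha> \<beta> :: "'a \<Rightarrow> 'a"
  assumes "q \<noteq> 0"
    and C: "\<And>k. C (Suc k) * \<beta> (q ^ Suc k) = q * \<alpha> (q ^ k) * C k"
    and t: "\<And>k. e * (\<alpha> (q ^ k) - \<beta> (q ^ k)) * C k = q ^ k * t k"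
    and "\<beta> 1 = 0"
  shows "(\<Sum>k<K. t k) = e * \<beta> (q ^ K) * C K / q ^ K"
proof (induction K)
  case 0
  then show ?case using assms by simp
next
  case (Suc K)
  have "t K = e * (\<alpha> (q ^ K) - \<beta> (q ^ K)) * C K / q ^ K"
    using t[of K] \<open>q \<noteq> 0\<close> by (simp add: field_simps)
  then have "(\<Sum>k<Suc K. t k) = e * (q * \<alpha> (q ^ K) * C K) / q ^ Suc K"
    using Suc \<open>q \<noteq> 0\<close> by (simp add: field_simps)
  also have "\<dots> = e * \<beta> (q ^ Suc K) * C (Suc K) / q ^ Suc K"
    by (subst C[symmetric]) (simp add: mult_ac)
  finally show ?case .
qed

text \<open>
  The summand of the Gasper-Rahman quadratic summation with \<open>a = q D F G\<close>, for \<open>b c = q\<close>; the parameters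
  \<open>d = q F G\<close>, \<open>f = q D G\<close>, \<open>g = q D F\<close> of the usual notation satisfy \<open>d f g = a^2 q\<close> and \<open>D = a / d\<close>,
  \<open>F = a / f\<close>, \<open>G = a / g\<close>.
\<close>

definition wp :: "complex \<Rightarrow> complex \<Rightarrow> complex \<Rightarrow> complex \<Rightarrow> complex \<Rightarrow> complex \<Rightarrow> nat \<Rightarrow> complex"
  where "wp q b c D F G k =
    (1 - q*D*F*G * q^(3*k)) * qpoch (q*D*F*G) q k * qpoch b q k * qpoch c q k *
    qpoch (q*F*G) (q^2) k * qpoch (q*D*G) (q^2) k * qpoch (q*D*F) (q^2) k * q^k /
    (qpoch (q^2) (q^2) k * qpoch (q*D*F*G*q*c) (q^2) k * qpoch (q*D*F*G*q*b) (q^2) k *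
     qpoch (q*D) q k * qpoch (q*F) q k * qpoch (q*G) q k)"

text \<open>Serves to insert two shift identities \<open>l = l'\<close> and \<open>n = n'\<close>
  into quotients of long products: once the common cofactor \<open>z\<close> is named, only
  rearrangement of factors remains.\<close>

lemma cross_divide2:
  fixes x y m p r s :: "'a::field"
  assumes "y \<noteq> 0" "s \<noteq> 0" "l = l'" "n = n'" "x * m * s = z * (l * n)" "p * r * y = z * (l' * n')"
  shows "x / y * m = p * (r / s)"
  using assms by (simp add: field_simps)

lemma cross_divide:
  fixes x y m p r s :: "'a::field"
  assumes "y \<noteq> 0" "s \<noteq> 0" "x * m * s = p * r * y"
  shows "x / y * m = p * (r / s)"
  using assms by (simp add: field_simps)

text \<open>The product of the first and third parameter is the same on both sides, so
  \<open>a\<close> does not change, and both summands are multiples of one core \<open>C k\<close>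
  by polynomials in \<open>q^k\<close>. Their combination telescopes by
  \<open>contiguous_identity_d\<close>, and the upper boundary term contains the vanishing
  \<open>qpoch (F*G) (q^2) K\<close>.\<close>

lemma wp_contiguous_d:
  fixes q b c E F G :: complex
  defines "a \<equiv> q*E*F*G"
  assumes "q \<noteq> 0" "b * c = q"
    and nz: "\<And>k. qpoch (q^2) (q^2) k \<noteq> 0" "\<And>k. qpoch (a*q*c) (q^2) k \<noteq> 0" "\<And>k. qpoch (a*q*b) (q^2) k \<noteq> 0"
      "\<And>k. qpoch E q k \<noteq> 0" "\<And>k. qpoch (q*F) q k \<noteq> 0" "\<And>k. qpoch G q k \<noteq> 0"
    and fin: "qpoch (F*G) (q^2) K = 0" and ne: "F*G \<noteq> 1" "E*F \<noteq> 1"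
  shows "(1-b*E)*(1-c*E)*(1-G)*(1-q*G)*(\<Sum>k<K. wp q b c (q*E) F (G/q) k)
       = (1-b*G)*(1-c*G)*(1-E)*(1-q*E)*(\<Sum>k<K. wp q b c (E/q) F (q*G) k)"
proof -
  \<comment> \<open>The core keeps the unshifted symbols in the numerator and the doubly shifted
    ones in the denominator, so that both summands are reached from it by polynomial
    factors.\<close>
  define C where "C k = qpoch a q k * qpoch b q k * qpoch c q k *
    qpoch (F*G) (q^2) k * qpoch (q*E*G) (q^2) k * qpoch (E*F) (q^2) k * q^k /
    (qpoch (q^2) (q^2) k * qpoch (a*q*c) (q^2) k * qpoch (a*q*b) (q^2) k *
     qpoch (q^2*E) q k * qpoch (q*F) q k * qpoch (q^2*G) q k)" for k
  define \<alpha> where "\<alpha> u = (1-a*u)*(1-b*u)*(1-c*u)*(1-F*G*u^2)*(1-E*F*u^2)*(1-q*E*G*u^2)" for u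
  define \<beta> where "\<beta> u = (1-u^2)*(1-b*E*F*G*u^2)*(1-c*E*F*G*u^2)*(1-q*E*u)*(1-F*u)*(1-q*G*u)" for u
  define t0 where "t0 = wp q b c (E/q) F (q*G)"
  define t1 where "t1 = wp q b c (q*E) F (G/q)"
  have E1: "1 - E \<noteq> 0" "1 - q*E \<noteq> 0" "1 - G \<noteq> 0" "1 - q*G \<noteq> 0"
    using nz(4)[of 1] nz(4)[of 2] nz(6)[of 1] nz(6)[of 2]
    by (simp_all add: qpoch_Suc numeral_2_eq_2 mult.commute)
  have nz2: "qpoch (q^2*E) q k \<noteq> 0" "qpoch (q^2*G) q k \<noteq> 0" for k
    using nz(4)[of "Suc (Suc k)"] nz(6)[of "Suc (Suc k)"]
    by (auto simp: qpoch_eq_0_iff power2_eq_square mult_ac)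
       (metis Suc_less_eq mult.left_commute power_Suc)+
  have t0: "t0 k * ((1-F*G)*(1-E)*(1-q*E)) = (1-a*q^(3*k))*(1-F*G*(q^k)^2)*(1-E*q^k)*(1-q*E*q^k) * C k" for k
  proof -
    have p1: "(1-F*G) * qpoch (q^2*(F*G)) (q^2) k = qpoch (F*G) (q^2) k * (1-F*G*(q^k)^2)"
      using qpoch_shift[of "F*G" "q^2" k] by (simp add: power_mult[symmetric] mult.commute)
    have p2: "(1-E)*(1-q*E)*qpoch (q^2*E) q k = qpoch E q k*(1-E*q^k)*(1-q*E*q^k)"
      by (rule qpoch_shift2)
    have e: "q*(E/q)*F*(q*G) = a" "q*F*(q*G) = q^2*(F*G)" "q*(E/q)*(q*G) = q*E*G" "q*(E/q)*F = E*F" "q*(E/q) = E" "q*(q*G) = q^2*G"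
      "E*F*(q*G) = a" "E*(q*G) = q*E*G"
      using \<open>q \<noteq> 0\<close> by (simp_all add: a_def power2_eq_square)
    show ?thesis unfolding t0_def wp_def e C_def
      apply (rule cross_divide2[OF _ _ p1 p2, where z = "(1-a*q^(3*k)) * qpoch a q k * q^k * qpoch (q^2) (q^2) k * qpoch (q*F) q k * qpoch b q k * qpoch c q k * qpoch (q*E*G) (q^2) k * qpoch (E*F) (q^2) k * qpoch (a*q*c) (q^2) k * qpoch (a*q*b) (q^2) k * qpoch (q^2*G) q k"])
      subgoal using nz nz2 by simp
      subgoal using nz nz2 by simp
       apply (simp only: mult_ac)
      apply (simp only: mult_ac)
      done
  qed
  have t1: "t1 k * ((1-E*F)*(1-G)*(1-q*G)) = (1-a*q^(3*k))*(1-E*F*(q^k)^2)*(1-G*q^k)*(1-q*G*q^k) * C k" for k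
  proof -
    have p1: "(1-E*F) * qpoch (q^2*(E*F)) (q^2) k = qpoch (E*F) (q^2) k * (1-E*F*(q^k)^2)"
      using qpoch_shift[of "E*F" "q^2" k] by (simp add: power_mult[symmetric] mult.commute)
    have p2: "(1-G)*(1-q*G)*qpoch (q^2*G) q k = qpoch G q k*(1-G*q^k)*(1-q*G*q^k)"
      by (rule qpoch_shift2)
    have e: "q*(q*E)*F*(G/q) = a" "q*F*(G/q) = F*G" "q*(q*E)*(G/q) = q*E*G" "q*(q*E)*F = q^2*(E*F)" "q*(G/q) = G" "q*(q*E) = q^2*E"
      "q^2*(E*F)*(G/q) = a" "q^2*E*(G/q) = q*E*G" "q^2*E*F = q^2*(E*F)"
      using \<open>q \<noteq> 0\<close> by (simp_all add: a_def power2_eq_square)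
    show ?thesis unfolding t1_def wp_def e C_def
      apply (rule cross_divide2[OF _ _ p1 p2, where z = "(1-a*q^(3*k)) * qpoch a q k * q^k * qpoch (q^2) (q^2) k * qpoch (q*F) q k * qpoch b q k * qpoch c q k * qpoch (q*E*G) (q^2) k * qpoch (F*G) (q^2) k * qpoch (a*q*c) (q^2) k * qpoch (a*q*b) (q^2) k * qpoch (q^2*E) q k"])
      subgoal using nz nz2 by simp
      subgoal using nz nz2 by simp
       apply (simp only: mult_ac)
      apply (simp only: mult_ac)
      done
  qed
  define t where "t k = (1-F*G)*(1-E*F)*((1-b*E)*(1-c*E)*(1-G)*(1-q*G)*t1 k
      - (1-b*G)*(1-c*G)*(1-E)*(1-q*E)*t0 k)" for k
  have "(\<Sum>k<K. t k) = (E-G) * \<beta> (q ^ K) * C K / q ^ K"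
  proof (rule gosper_sum)
    fix k
    define u where "u = q^k"
    have s: "qpoch (q^2) (q^2) (Suc k) = qpoch (q^2) (q^2) k * (1-q^2*u^2)"
      "qpoch (a*q*c) (q^2) (Suc k) = qpoch (a*q*c) (q^2) k * (1-a*q*c*u^2)"
      "qpoch (a*q*b) (q^2) (Suc k) = qpoch (a*q*b) (q^2) k * (1-a*q*b*u^2)"
      "qpoch (q^2*E) q (Suc k) = qpoch (q^2*E) q k * (1-q^2*E*u)"
      "qpoch (q*F) q (Suc k) = qpoch (q*F) q k * (1-q*F*u)"
      "qpoch (q^2*G) q (Suc k) = qpoch (q^2*G) q k * (1-q^2*G*u)"
      by (simp_all add: qpoch_Suc u_def power_mult[symmetric] mult.commute)
    have s': "qpoch a q (Suc k) = qpoch a q k * (1-a*u)" "qpoch b q (Suc k) = qpoch b q k * (1-b*u)"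
      "qpoch c q (Suc k) = qpoch c q k * (1-c*u)"
      "qpoch (F*G) (q^2) (Suc k) = qpoch (F*G) (q^2) k * (1-F*G*u^2)"
      "qpoch (q*E*G) (q^2) (Suc k) = qpoch (q*E*G) (q^2) k * (1-q*E*G*u^2)"
      "qpoch (E*F) (q^2) (Suc k) = qpoch (E*F) (q^2) k * (1-E*F*u^2)"
      by (simp_all add: qpoch_Suc u_def power_mult[symmetric] mult.commute)
    have \<beta>: "\<beta> (q ^ Suc k) = (1-q^2*u^2)*(1-a*q*c*u^2)*(1-a*q*b*u^2)*(1-q^2*E*u)*(1-q*F*u)*(1-q^2*G*u)"
      unfolding \<beta>_def a_def u_def power_Suc by algebra
    show "C (Suc k) * \<beta> (q ^ Suc k) = q * \<alpha> (q ^ k) * C k"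
      unfolding C_def
      apply (rule cross_divide)
      subgoal using nz nz2 by simp
      subgoal using nz nz2 by simp
      unfolding s s' \<beta> \<alpha>_def u_def[symmetric] by (simp add: mult_ac u_def)
    have K: "(E-G)*(\<alpha> u - \<beta> u) = u*(1-a*u^3)*((1-F*G)*((1-b*E)*(1-c*E))*(1-E*F*u^2)*(1-q*G*u)*(1-G*u)
      - (1-E*F)*((1-b*G)*(1-c*G))*(1-F*G*u^2)*(1-E*u)*(1-q*E*u))"
    proof -
      have r: "1-(b+c)*x+q*x^2 = (1-b*x)*(1-c*x)" "q*x^2-(b+c)*x+1 = (1-b*x)*(1-c*x)" for x
        by (simp_all add: \<open>b*c=q\<close>[symmetric] algebra_simps power2_eq_square)
      have r2: "1-(b+c)*(E*F*G)*u^2+q*(E*F*G)^2*u^4 = (1-b*E*F*G*u^2)*(1-c*E*F*G*u^2)"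
        unfolding \<open>b*c=q\<close>[symmetric] by algebra
      show ?thesis using contiguous_identity_d[of E G q F u "b+c"]
        unfolding r r2 \<alpha>_def \<beta>_def a_def by (simp only: mult.assoc)
    qed
    have u3: "q^(3*k) = u^3" by (simp add: u_def power_mult[symmetric] mult.commute)
    show "(E-G) * (\<alpha> (q ^ k) - \<beta> (q ^ k)) * C k = q ^ k * t k"
      unfolding u_def[symmetric] K t_def using t0[of k] t1[of k] unfolding u_def[symmetric] u3
      by algebra
  qed (use \<open>q \<noteq> 0\<close> in \<open>simp_all add: \<beta>_def\<close>)
  also have "C K = 0" using fin by (simp add: C_def)
  finally have "(1-F*G)*(1-E*F)*((1-b*E)*(1-c*E)*(1-G)*(1-q*G)*(\<Sum>k<K. t1 k)
      - (1-b*G)*(1-c*G)*(1-E)*(1-q*E)*(\<Sum>k<K. t0 k)) = 0"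
    by (simp add: t_def sum_subtractf sum_distrib_left[symmetric])
  then show ?thesis using ne by (simp add: t0_def t1_def)
qed

text \<open>With \<open>q * b * c = 1\<close> both pairs \<open>(q^2*b, c)\<close> and
  \<open>(b, q^2*c)\<close> have product \<open>q\<close>, the case for which \<open>wp\<close> is
  meant. The boundary term now disappears through \<open>qpoch b q K = 0\<close>.\<close>

lemma wp_contiguous_b:
  fixes q b c D F G :: complex
  defines "a \<equiv> q*D*F*G"
  assumes "q \<noteq> 0" "q * b * c = 1"
    and nz: "\<And>k. qpoch (q^2) (q^2) k \<noteq> 0" "\<And>k. qpoch (a*q*c) (q^2) k \<noteq> 0" "\<And>k. qpoch (a*q*b) (q^2) k \<noteq> 0"
      "\<And>k. qpoch (q*D) q k \<noteq> 0" "\<And>k. qpoch (q*F) q k \<noteq> 0" "\<And>k. qpoch (q*G) q k \<noteq> 0"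
    and fin: "qpoch b q K = 0"
  shows "b*(c-D)*(c-F)*(c-G)*(1-b)*(1-q*b)*(1-a*q*c)*(\<Sum>k<K. wp q (q^2*b) c D F G k)
       = c*(b-D)*(b-F)*(b-G)*(1-c)*(1-q*c)*(1-a*q*b)*(\<Sum>k<K. wp q b (q^2*c) D F G k)"
proof -
  define C where "C k = qpoch a q k * qpoch b q k * qpoch c q k *
    qpoch (q*F*G) (q^2) k * qpoch (q*D*G) (q^2) k * qpoch (q*D*F) (q^2) k * q^k /
    (qpoch (q^2) (q^2) k * qpoch (q^2*(a*q*c)) (q^2) k * qpoch (q^2*(a*q*b)) (q^2) k *
     qpoch (q*D) q k * qpoch (q*F) q k * qpoch (q*G) q k)" for k
  define \<alpha> where "\<alpha> u = (1-a*u)*(1-b*u)*(1-c*u)*(1-q*F*G*u^2)*(1-q*D*G*u^2)*(1-q*D*F*u^2)" for u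
  define \<beta> where "\<beta> u = (1-u^2)*(1-a*q*b*u^2)*(1-a*q*c*u^2)*(1-D*u)*(1-F*u)*(1-G*u)" for u
  define t0 where "t0 = wp q (q^2*b) c D F G"
  define t1 where "t1 = wp q b (q^2*c) D F G"
  have nz2: "qpoch (q^2*(a*q*b)) (q^2) k \<noteq> 0" "qpoch (q^2*(a*q*c)) (q^2) k \<noteq> 0" for k
  proof -
    have "qpoch (x*y) x k \<noteq> 0" if "\<And>k. qpoch y x k \<noteq> 0" for x y :: complex
      using qpoch_shift[of y x k] that[of "Suc k"] by (auto simp: qpoch_Suc)
    with nz show "qpoch (q^2*(a*q*b)) (q^2) k \<noteq> 0" "qpoch (q^2*(a*q*c)) (q^2) k \<noteq> 0" by blast+
  qed
  have p: "(1-x) * qpoch (q^2*x) (q^2) k = qpoch x (q^2) k * (1-x*(q^k)^2)" for x k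
    using qpoch_shift[of x "q^2" k] by (simp add: power_mult[symmetric] mult.commute)
  have t0: "t0 k * ((1-b)*(1-q*b)*(1-a*q*c)) = (1-a*q^(3*k))*(1-b*q^k)*(1-q*b*q^k)*(1-a*q*c*(q^k)^2) * C k" for k
  proof -
    have e: "q*D*F*G = a" "a*q*(q^2*b) = q^2*(a*q*b)" by (simp_all add: a_def)
    show ?thesis unfolding t0_def wp_def e C_def
      apply (rule cross_divide2[OF _ _ p[of "a*q*c" k] qpoch_shift2[of b q k], where z = "(1-a*q^(3*k)) * qpoch a q k * q^k * qpoch (q^2) (q^2) k * qpoch (q*F) q k * qpoch c q k * qpoch (q*F*G) (q^2) k * qpoch (q*D*G) (q^2) k * qpoch (q*D*F) (q^2) k * qpoch (q^2*(a*q*b)) (q^2) k * qpoch (q*D) q k * qpoch (q*G) q k"])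
      subgoal using nz nz2 by simp
      subgoal using nz nz2 by simp
       apply (simp only: mult_ac)
      apply (simp only: mult_ac)
      done
  qed
  have t1: "t1 k * ((1-c)*(1-q*c)*(1-a*q*b)) = (1-a*q^(3*k))*(1-c*q^k)*(1-q*c*q^k)*(1-a*q*b*(q^k)^2) * C k" for k
  proof -
    have e: "q*D*F*G = a" "a*q*(q^2*c) = q^2*(a*q*c)" by (simp_all add: a_def)
    show ?thesis unfolding t1_def wp_def e C_def
      apply (rule cross_divide2[OF _ _ p[of "a*q*b" k] qpoch_shift2[of c q k], where z = "(1-a*q^(3*k)) * qpoch a q k * q^k * qpoch (q^2) (q^2) k * qpoch (q*F) q k * qpoch b q k * qpoch (q*F*G) (q^2) k * qpoch (q*D*G) (q^2) k * qpoch (q*D*F) (q^2) k * qpoch (q^2*(a*q*c)) (q^2) k * qpoch (q*D) q k * qpoch (q*G) q k"])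
      subgoal using nz nz2 by simp
      subgoal using nz nz2 by simp
       apply (simp only: mult_ac)
      apply (simp only: mult_ac)
      done
  qed
  define t where "t k = q * (b*(c-D)*(c-F)*(c-G)*(1-b)*(1-q*b)*(1-a*q*c)*t0 k
       - c*(b-D)*(b-F)*(b-G)*(1-c)*(1-q*c)*(1-a*q*b)*t1 k)" for k
  have "(\<Sum>k<K. t k) = (b-c) * \<beta> (q ^ K) * C K / q ^ K"
  proof (rule gosper_sum)
    fix k
    define u where "u = q^k"
    have s: "qpoch x q (Suc k) = qpoch x q k * (1-x*u)" "qpoch x (q^2) (Suc k) = qpoch x (q^2) k * (1-x*u^2)" for x
      by (simp_all add: qpoch_Suc u_def power_mult[symmetric] mult.commute)
    have \<beta>: "\<beta> (q ^ Suc k) = (1-q^2*u^2)*(1-q^2*(a*q*c)*u^2)*(1-q^2*(a*q*b)*u^2)*(1-q*D*u)*(1-q*F*u)*(1-q*G*u)"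
      unfolding \<beta>_def by (simp add: u_def) algebra
    show "C (Suc k) * \<beta> (q ^ Suc k) = q * \<alpha> (q ^ k) * C k"
      unfolding C_def
      apply (rule cross_divide)
      subgoal using nz nz2 by simp
      subgoal using nz nz2 by simp
      unfolding s \<beta> \<alpha>_def u_def[symmetric] by (simp add: mult_ac u_def)
    have u3: "q^(3*k) = u^3" by (simp add: u_def power_mult[symmetric] mult.commute)
    show "(b-c) * (\<alpha> (q ^ k) - \<beta> (q ^ k)) * C k = q ^ k * t k"
      using contiguous_identity_b[OF \<open>q*b*c = 1\<close>, of D F G u] t0[of k] t1[of k]
      unfolding \<alpha>_def \<beta>_def t_def a_def[symmetric] u_def[symmetric] u3 by algebra
  qed (use \<open>q \<noteq> 0\<close> in \<open>simp_all add: \<beta>_def\<close>)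
  also have "C K = 0" using fin by (simp add: C_def)
  finally show ?thesis using \<open>q \<noteq> 0\<close>
    by (simp add: t_def t0_def t1_def sum_subtractf sum_distrib_left[symmetric])
qed

text \<open>The three last parameters multiply to \<open>a / q\<close>, and \<open>q\<close> times
  the last two is \<open>q^(-2*N)\<close>, which stops the series at \<open>k = N\<close>. Passing
  from \<open>N\<close> to \<open>Suc N\<close> is one step of \<open>wp_contiguous_d\<close>, whose
  prefactors are the new factors of the closed form.\<close>

lemma wp_quadratic_sum:
  fixes q a b c f :: complex
  assumes "q \<noteq> 0" "a \<noteq> 0" "f \<noteq> 0" "b * c = q"
    and q: "\<And>j. q ^ Suc j \<noteq> 1" and a: "\<And>j. a * q ^ Suc j \<noteq> 1"
    and ac: "\<And>j. a * c * q ^ (2*j+1) \<noteq> 1" and ab: "\<And>j. a * b * q ^ (2*j+1) \<noteq> 1"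
    and f: "\<And>i j. f * q ^ i \<noteq> a * q ^ j" and g: "\<And>j. a^2 * q ^ Suc j \<noteq> f"
  shows "(\<Sum>k\<le>N. wp q b c (a * q^(2*N)) (a/f) (f/(a*q^(2*N+1))) k)
    = (1 - a) * (qpoch (a*q) q (2*N) * qpoch (a*q*c/f) (q^2) N * qpoch (a*q*b/f) (q^2) N /
       (qpoch (a*q/f) q (2*N) * qpoch (a*q*c) (q^2) N * qpoch (a*q*b) (q^2) N))"
proof (induction N)
  case 0
  show ?case using assms(1-3) by (simp add: wp_def)
next
  case (Suc N)
  define v where "v = q^(2*N)"
  have v: "v \<noteq> 0" using assms by (simp add: v_def)
  \<comment> \<open>Parameters midway between the two cases: \<open>E/q\<close> and
    \<open>q*G\<close> belong to \<open>N\<close>, while \<open>q*E\<close> and \<open>G/q\<close>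
    belong to \<open>Suc N\<close>.\<close>
  define E where "E = a*q* v"
  define G where "G = f/(a*q^2* v)"
  have FG: "(a/f)*G = 1/q^(2*Suc N)" "E*(a/f)*f = a^2*q^(2*N+1)"
    using assms(1-3) v by (auto simp: E_def G_def v_def power2_eq_square)
  have aE: "q*E*(a/f)*G = a"
    using assms(1-3) v by (auto simp: E_def G_def power2_eq_square)
  \<comment> \<open>Both sums get the range of the longer one, as the contiguous relation requires;
    the extra term of \<open>S0\<close> is zero because its series already stops at
    \<open>N\<close>.\<close>
  define S0 where "S0 = (\<Sum>k<Suc (Suc N). wp q b c (E/q) (a/f) (q*G) k)"
  define S1 where "S1 = (\<Sum>k<Suc (Suc N). wp q b c (q*E) (a/f) (G/q) k)"
  have fG: "G * (a*q^2* v) = f" using assms(1-3) v by (simp add: G_def)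
  have "(1-b*E)*(1-c*E)*(1-G)*(1-q*G)*S1 = (1-b*G)*(1-c*G)*(1-E)*(1-q*E)*S0"
    unfolding S0_def S1_def
  proof (rule wp_contiguous_d; (unfold aE)?)
    show "qpoch (q^2) (q^2) k \<noteq> 0" for k
      using q by (auto simp: qpoch_eq_0_iff simp flip: power_mult power_add power_Suc)
    show "qpoch (a*q*c) (q^2) k \<noteq> 0" for k
      using ac by (auto simp: qpoch_eq_0_iff mult_ac simp flip: power_mult)
    show "qpoch (a*q*b) (q^2) k \<noteq> 0" for k
      using ab by (auto simp: qpoch_eq_0_iff mult_ac simp flip: power_mult)
    show "qpoch E q k \<noteq> 0" for k
    proof -
      have "E * q^j = a * q ^ Suc (2*N+j)" for j by (simp add: E_def v_def power_add)
      then show ?thesis using a by (simp only: qpoch_eq_0_iff) blast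
    qed
    show "qpoch (q * (a/f)) q k \<noteq> 0" for k
    proof -
      have "f * q^0 = a * q^Suc j" if "q * (a/f) * q^j = 1" for j
        using that assms(3) by (simp add: field_simps)
      then show ?thesis using f by (simp only: qpoch_eq_0_iff) blast
    qed
    show "qpoch G q k \<noteq> 0" for k
    proof -
      have "f * q^j = a * q^(2*N+2)" if "G * q^j = 1" for j
      proof -
        have "f * q^j = (a*q^2* v) * (G * q^j)" unfolding fG[symmetric] by (simp only: mult_ac)
        then show ?thesis using that by (simp add: v_def power_add power2_eq_square mult_ac)
      qed
      then show ?thesis using f by (simp only: qpoch_eq_0_iff) blast
    qed
    show "qpoch (a/f*G) (q^2) (Suc (Suc N)) = 0"
      unfolding FG qpoch_eq_0_iff using \<open>q \<noteq> 0\<close>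
      by (intro exI[of _ "Suc N"]) (simp del: power_Suc flip: power_mult)
    show "a/f*G \<noteq> 1"
      unfolding FG using q[of "2*N+1"] \<open>q \<noteq> 0\<close> by (auto simp: field_simps)
    show "E*(a/f) \<noteq> 1"
      using FG(2) g[of "2*N"] by auto
  qed (use assms in auto)
  moreover have "S0 = (\<Sum>k\<le>N. wp q b c (a * q^(2*N)) (a/f) (f/(a*q^(2*N+1))) k)"
  proof -
    have "E/q = a*q^(2*N)" "q*G = f/(a*q^(2*N+1))"
      using assms(1-3) by (simp_all add: E_def G_def v_def power2_eq_square)
    moreover have "wp q b c (E/q) (a/f) (q*G) (Suc N) = 0"
    proof -
      have "q*(a/f)*(q*G) = 1/q^(2*N)" using FG \<open>q \<noteq> 0\<close> by (simp add: power2_eq_square field_simps)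
      then have "qpoch (q*(a/f)*(q*G)) (q^2) (Suc N) = 0"
        unfolding qpoch_eq_0_iff using \<open>q \<noteq> 0\<close> by (intro exI[of _ N]) (simp flip: power_mult)
      then show ?thesis by (simp add: wp_def)
    qed
    ultimately show ?thesis unfolding S0_def by (simp add: lessThan_Suc_atMost)
  qed
  moreover have "S1 = (\<Sum>k\<le>Suc N. wp q b c (a * q^(2*Suc N)) (a/f) (f/(a*q^(2*Suc N+1))) k)"
  proof -
    have "q*E = a*q^(2*Suc N)" "G/q = f/(a*q^(2*Suc N+1))"
      using assms(1-3) by (simp_all add: E_def G_def v_def power2_eq_square)
    then show ?thesis unfolding S1_def by (simp only: lessThan_Suc_atMost)
  qed
  ultimately have rec: "(1-b*E)*(1-c*E)*(1-G)*(1-q*G)*(\<Sum>k\<le>Suc N. wp q b c (a * q^(2*Suc N)) (a/f) (f/(a*q^(2*Suc N+1))) k)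
     = (1-b*G)*(1-c*G)*(1-E)*(1-q*E)* ((1 - a) * (qpoch (a*q) q (2*N) * qpoch (a*q*c/f) (q^2) N * qpoch (a*q*b/f) (q^2) N /
       (qpoch (a*q/f) q (2*N) * qpoch (a*q*c) (q^2) N * qpoch (a*q*b) (q^2) N)))"
    using Suc by simp
  define H where "H = a*q* v/f"
  have H: "H * (q*G) = 1" "H \<noteq> 0" using assms(1-3) v by (simp_all add: H_def G_def field_simps power2_eq_square)
  have p1: "qpoch (a*q) q (2*Suc N) = qpoch (a*q) q (2*N) * (1-E)*(1-q*E)"
    by (simp add: qpoch_Suc E_def v_def mult_ac)
  have p2: "qpoch (a*q/f) q (2*Suc N) = qpoch (a*q/f) q (2*N) * (1-H)*(1-q*H)"
    by (simp add: qpoch_Suc H_def v_def mult_ac)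
  have pq: "(q^2)^N = v" by (simp add: v_def power_mult)
  have p3: "qpoch (a*q*c/f) (q^2) (Suc N) = qpoch (a*q*c/f) (q^2) N * (1 - c*H)"
    "qpoch (a*q*b/f) (q^2) (Suc N) = qpoch (a*q*b/f) (q^2) N * (1 - b*H)"
    by (simp_all add: qpoch_Suc H_def pq mult_ac)
  have p4: "qpoch (a*q*c) (q^2) (Suc N) = qpoch (a*q*c) (q^2) N * (1 - c*E)"
    "qpoch (a*q*b) (q^2) (Suc N) = qpoch (a*q*b) (q^2) N * (1 - b*E)"
    by (simp_all add: qpoch_Suc E_def pq mult_ac)
  have n1: "1-b*E \<noteq> 0" "1-c*E \<noteq> 0"
    using ab[of N] ac[of N] by (auto simp: E_def v_def mult_ac)
  have n2: "1-G \<noteq> 0" "1-q*G \<noteq> 0"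
    using f[of 0 "2*N+2"] f[of 1 "2*N+2"] fG by (auto simp: v_def power_add power2_eq_square mult_ac)
  have n3: "1-H \<noteq> 0" "1-q*H \<noteq> 0"
    using f[of 0 "2*N+1"] f[of 0 "2*N+2"] assms(1-3) by (auto simp: H_def v_def power_add power2_eq_square field_simps)
  \<comment> \<open>Inverting each argument by \<open>H = 1/(q*G)\<close> exchanges
    \<open>b*G\<close> with \<open>1/(c*H)\<close>; the monomials that come out cancel because
    \<open>b*c = q\<close>.\<close>
  have r: "(1-b*G)*(1-c*G)*((1-H)*(1-q*H)) = (1-G)*(1-q*G)*((1-c*H)*(1-b*H))"
    using H(1) \<open>b*c = q\<close> by algebra
  have alg: "S = A * (C1 * (1-E)*(1-q*E) * (C2*(1-c*H)) * (C3*(1-b*H)) / (C4 * (1-H)*(1-q*H) * (C5 * (1-c*E)) * (C6 * (1-b*E))))"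
    if h: "(1-b*E)*(1-c*E)*(1-G)*(1-q*G)*S = (1-b*G)*(1-c*G)*(1-E)*(1-q*E)*(A*(C1*C2*C3/(C4*C5*C6)))"
    for S A C1 C2 C3 C4 C5 C6
  proof -
    define Z where "Z = A*(C1*C2*C3/(C4*C5*C6))"
    have "S = (1-b*G)*(1-c*G)/((1-G)*(1-q*G)) * ((1-E)*(1-q*E)/((1-b*E)*(1-c*E)) * Z)"
      using h n1 n2 unfolding Z_def[symmetric] by (simp add: divide_simps mult_ac)
    also have "(1-b*G)*(1-c*G)/((1-G)*(1-q*G)) = (1-c*H)*(1-b*H)/((1-H)*(1-q*H))"
      using r n2 n3 by (simp add: frac_eq_eq mult_ac)
    finally show ?thesis unfolding Z_def by (simp add: mult_ac)
  qed
  show ?case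
    unfolding p1 p2 p3 p4 by (rule alg[OF rec])
qed

text \<open>Termination through \<open>b\<close>: the contiguous relation steps from \<open>b = q^(-2(2m+1))\<close> to the next odd case.\<close>

lemma wp_sum_eq_0:
  fixes q :: complex
  assumes "q \<noteq> 0" and q: "\<And>j. q ^ Suc j \<noteq> 1"
  shows "(\<Sum>k<2*m+2. wp (q^2) (1/q^(2*(2*m+1))) (q^(4*m+4)) 1 1 (1/q) k) = 0"
proof (induction m)
  \<comment> \<open>Only the terms \<open>k = 0\<close> and \<open>k = 1\<close> are present, and
    they are \<open>1 - q\<close> and \<open>-(1 - q)\<close>.\<close>
  case 0
  have "q \<noteq> 1" "q^2 \<noteq> 1" using q[of 0] q[of 1] by (auto simp: power2_eq_square)
  moreover have "q^4 \<noteq> 1" "q^7 \<noteq> 1" using q[of 3] q[of 6] by simp_all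
  moreover have "q^2*1*1*(1/q) = q" "q^2*1*(1/q) = q" "q^2*(1/q) = q" "q^3/q^2 = q"
    using \<open>q \<noteq> 0\<close> by (simp_all add: power2_eq_square power3_eq_cube)
  then have "wp (q^2) (1/q^2) (q^4) 1 1 (1/q) 0 = 1 - q"
    "wp (q^2) (1/q^2) (q^4) 1 1 (1/q) 1 =
      (1-q^7)*(1-q)*(1-1/q^2)*(1-q^4)*(1-q)*(1-q)*(1-q^2)*q^2 / ((1-q^4)*(1-q^7)*(1-q)*(1-q^2)*(1-q^2)*(1-q))"
    using \<open>q \<noteq> 0\<close>
    by (simp_all add: wp_def qpoch_Suc flip: power_mult power_add power_Suc power_Suc2)
  ultimately have "wp (q^2) (1/q^2) (q^4) 1 1 (1/q) 0 = 1 - q" "wp (q^2) (1/q^2) (q^4) 1 1 (1/q) 1 = (1-1/q^2)*q^2*(1-q)/(1-q^2)"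
    by (simp_all add: divide_simps)
  moreover have "(1-1/q^2)*q^2*(1-q)/(1-q^2) = -(1-q)"
    using \<open>q \<noteq> 0\<close> \<open>q^2 \<noteq> 1\<close> by (simp add: divide_simps) (simp add: algebra_simps)
  moreover have "{..<2*0+2::nat} = {0,1}" by auto
  ultimately show ?case by simp
next
  case (Suc m)
  \<comment> \<open>In base \<open>q^2\<close>, the pair \<open>((q^2)^2*b, c)\<close> is that of
    \<open>m\<close> and \<open>(b, (q^2)^2*c)\<close> that of \<open>Suc m\<close>. One step
    multiplies by \<open>q^4\<close>, hence preserves the parity of the terminating index.\<close>
  define b where "b = 1/q^(2*(2*m+3))"
  define c where "c = q^(4*m+4)"
  have bc: "q^2*b*c = 1" "(q^2)^2*b = 1/q^(2*(2*m+1))" "(q^2)^2*c = q^(4*Suc m+4)"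
  proof -
    have h: "q^(2*(2*m+3)) = q^2*q^(4*m+4)" "q^(2*(2*m+3)) = (q^2)^2*q^(2*(2*m+1))" "q^(4*Suc m+4) = (q^2)^2*q^(4*m+4)"
      by (simp_all only: power_mult[symmetric] power_add[symmetric]; rule arg_cong[where f="power q"]; simp)+
    show "q^2*b*c = 1"
      unfolding b_def c_def h(1) using \<open>q \<noteq> 0\<close> by simp
    show "(q^2)^2*b = 1/q^(2*(2*m+1))"
      unfolding b_def h(2) using \<open>q \<noteq> 0\<close> by simp
    show "(q^2)^2*c = q^(4*Suc m+4)"
      unfolding c_def h(3) ..
  qed
  have q': "q ^ j \<noteq> 1" if "j > 0" for j
    using q[of "j-1"] that by simp
  have b: "b * q ^ j = 1 \<longleftrightarrow> j = 4*m+6" for j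
  proof -
    have "b * q ^ j = 1 \<longleftrightarrow> q ^ j = q ^ (4*m+6)"
      using \<open>q \<noteq> 0\<close> by (auto simp: b_def field_simps)
    also have "\<dots> \<longleftrightarrow> j = 4*m+6"
    proof
      assume *: "q ^ j = q ^ (4*m+6)"
      have "i = l" if "i \<le> l" "q ^ i = q ^ l" for i l
        using that q'[of "l-i"] \<open>q \<noteq> 0\<close> by (cases "i = l") (auto simp: le_iff_add power_add)
      with * show "j = 4*m+6" by (metis nat_le_linear)
    qed auto
    finally show ?thesis .
  qed
  have qinv: "1/q * q ^ Suc j = q ^ j" for j using \<open>q \<noteq> 0\<close> by simp
  let ?K = "2 * Suc m + 2"
  have *: "b*(c-1)*(c-1)*(c-1/q)*(1-b)*(1-q^2*b)*(1-q*q^2*c)*(\<Sum>k<?K. wp (q^2) ((q^2)^2*b) c 1 1 (1/q) k)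
       = c*(b-1)*(b-1)*(b-1/q)*(1-c)*(1-q^2*c)*(1-q*q^2*b)*(\<Sum>k<?K. wp (q^2) b ((q^2)^2*c) 1 1 (1/q) k)"
  proof -
    have a: "q^2*1*1*(1/q) = q" using \<open>q \<noteq> 0\<close> by (simp add: power2_eq_square)
    have e: "(q^2)^j = q^(2*j)" "((q^2)^2)^j = q^(4*j)" for j by (simp_all flip: power_mult)
    have *: "q * q^2 * b * q^(4*j) = b * q^(4*j+3)" for j by (simp add: power_add eval_nat_numeral)
    show ?thesis
    proof (rule wp_contiguous_b[of "q^2" b c 1 1 "1/q" ?K, unfolded a])
      show "qpoch b (q^2) ?K = 0"
        unfolding qpoch_eq_0_iff e b by (intro exI[of _ "2*m+3"]) simp
      show "qpoch ((q^2)^2) ((q^2)^2) k \<noteq> 0" for k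
        using q' unfolding qpoch_eq_0_iff by (simp flip: power_mult power_add)
      show "qpoch (q*q^2*c) ((q^2)^2) k \<noteq> 0" for k
        using q' unfolding qpoch_eq_0_iff c_def by (simp flip: power_mult power_add power_Suc)
      \<comment> \<open>The exponent \<open>4*j+3\<close> is odd, whereas \<open>b\<close> is the
        inverse of an even power of \<open>q\<close>.\<close>
      show "qpoch (q*q^2*b) ((q^2)^2) k \<noteq> 0" for k
        unfolding qpoch_eq_0_iff e(2) * b by presburger
      have *: "q^2*1*(q^2)^j = q^(2+2*j)" for j
        by (simp only: mult_1_right power_add power_mult)
      show "qpoch (q^2*1) (q^2) k \<noteq> 0" for k
        unfolding qpoch_eq_0_iff * using q' by (simp del: power_Suc add_2_eq_Suc)
      then show "qpoch (q^2*1) (q^2) k \<noteq> 0" for k .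
      have "q^2*(1/q) = q" using \<open>q \<noteq> 0\<close> by (simp add: power2_eq_square)
      then show "qpoch (q^2*(1/q)) (q^2) k \<noteq> 0" for k
        using q' unfolding qpoch_eq_0_iff by (simp flip: power_mult power_Suc)
    qed (use \<open>q \<noteq> 0\<close> bc in auto)
  qed
  \<comment> \<open>The contiguous relation is stated with the longer range of the new case; the old
    series has already terminated.\<close>
  have "(\<Sum>k<?K. wp (q^2) ((q^2)^2*b) c 1 1 (1/q) k) = (\<Sum>k<2*m+2. wp (q^2) ((q^2)^2*b) c 1 1 (1/q) k)"
  proof (rule sum.mono_neutral_right)
    have "qpoch ((q^2)^2*b) (q^2) k = 0" if "k \<ge> 2*m+2" for k
      unfolding qpoch_eq_0_iff bc(2) power_mult using that \<open>q \<noteq> 0\<close>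
      by (intro exI[of _ "2*m+1"]) (simp del: power_Suc)
    then show "\<forall>k\<in>{..<?K} - {..<2*m+2}. wp (q^2) ((q^2)^2*b) c 1 1 (1/q) k = 0"
      by (simp add: wp_def)
  qed auto
  also have "\<dots> = 0"
    using Suc by (simp only: bc(2) c_def)
  finally have "c*(b-1)*(b-1)*(b-1/q)*(1-c)*(1-q^2*c)*(1-q*q^2*b)*(\<Sum>k<?K. wp (q^2) b ((q^2)^2*c) 1 1 (1/q) k) = 0"
    using * by simp
  moreover have "c \<noteq> 0" "b \<noteq> 1" "b \<noteq> 1/q" "c \<noteq> 1" "q^2*c \<noteq> 1" "q*q^2*b \<noteq> 1"
  proof -
    have "q^2*c = q^(2+(4*m+4))" by (simp only: c_def power_add)
    then show "q^2*c \<noteq> 1" using q'[of "2+(4*m+4)"] by (simp only: simp_thms)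
    have "q*q^2*b = b*q^3" by (simp add: eval_nat_numeral)
    moreover have "b*q^3 \<noteq> 1" using b[of 3] by simp
    ultimately show "q*q^2*b \<noteq> 1" by (simp only: simp_thms)
  qed (use \<open>q \<noteq> 0\<close> q'[of "4*m+4"] b[of 0] b[of 1] in \<open>auto simp: c_def\<close>)
  ultimately have "(\<Sum>k<?K. wp (q^2) b ((q^2)^2*c) 1 1 (1/q) k) = 0" by auto
  moreover have "2*Suc m+1 = 2*m+3" by simp
  then have "b = 1/q^(2*(2*Suc m+1))" by (simp only: b_def)
  ultimately show ?case by (simp only: bc(3))
qed

subsection \<open>A two-parameter deformation of the sum\<close>

text \<open>
  The deformation replaces pairs \<open>(1 - u)^2\<close> by \<open>(1 - u x) (1 - u / x)\<close>. This depends on \<open>x\<close> only through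
  \<open>X = 2 - x - 1 / x\<close>, which is the variable used here; the undeformed case is \<open>X = 0\<close>.
\<close>

definition quad :: "complex \<Rightarrow> complex \<Rightarrow> complex"
  where "quad u X = (1 - u)^2 + u * X"

lemma quad_0 [simp]: "quad u 0 = (1 - u)^2"
  by (simp add: quad_def)

lemma quad_factor: "x \<noteq> 0 \<Longrightarrow> quad u (2 - x - 1/x) = (1 - u * x) * (1 - u / x)"
  by (simp add: quad_def field_simps power2_eq_square)

definition quad_ratio :: "(nat \<Rightarrow> nat) \<Rightarrow> (nat \<Rightarrow> nat) \<Rightarrow> nat \<Rightarrow> complex \<Rightarrow> complex \<Rightarrow> complex"
  where "quad_ratio e e' k q X = (\<Prod>j<k. quad (q ^ e j) X / quad (q ^ e' j) X)"

text \<open>The pairing of numerators with denominators is the one that \<open>wp\<close> allows in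
  base \<open>q^2\<close>: the first two parameters \<open>q*x\<close>, \<open>q/x\<close> also
  enter the denominators \<open>q^4/x\<close>, \<open>q^4*x\<close>, and \<open>1/y\<close>,
  \<open>y\<close> enter numerators in base \<open>q^4\<close> and denominators in base
  \<open>q^2\<close>. \<open>facW\<close> is the part of the closed form that depends on
  \<open>X\<close>.\<close>

abbreviation "facA \<equiv> quad_ratio (\<lambda>j. 2*j+1) (\<lambda>j. 4*j+4)"
abbreviation "facB \<equiv> quad_ratio (\<lambda>j. 4*j+1) (\<lambda>j. 2*j+2)"
abbreviation "facW \<equiv> quad_ratio (\<lambda>j. 4*j+2) (\<lambda>j. 4*j+4)"

definition coef :: "nat \<Rightarrow> complex \<Rightarrow> complex"
  where "coef k q = qint q (6*k+1) * q^(2*k) * (\<Prod>j<k. (1 - q^(4*j+2)) / (1 - q^(4*j+4)))"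

definition deformed_sum :: "nat \<Rightarrow> complex \<Rightarrow> complex \<Rightarrow> complex \<Rightarrow> complex"
  where "deformed_sum n q X Y = (\<Sum>k<n. coef k q * facA k q X * facB k q Y)"

lemma prod_factor_qpoch: "(\<Prod>j<k. 1 - q^(r*j+s) * x) = qpoch (q^s * x) (q^r) k"
  unfolding qpoch_def power_add power_mult by (intro prod.cong) auto

lemma quad_ratio_qpoch:
  assumes "x \<noteq> 0"
  shows "quad_ratio (\<lambda>j. r*j+s) (\<lambda>j. r'*j+s') k q (2 - x - 1/x)
    = qpoch (q^s*x) (q^r) k * qpoch (q^s/x) (q^r) k / (qpoch (q^s'*x) (q^r') k * qpoch (q^s'/x) (q^r') k)"
  using prod_factor_qpoch[of q r s x k] prod_factor_qpoch[of q r s "1/x" k]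
    prod_factor_qpoch[of q r' s' x k] prod_factor_qpoch[of q r' s' "1/x" k] assms
  by (simp add: quad_ratio_def quad_factor prod_dividef prod.distrib)

lemma coef_qpoch:
  "coef k q = (1 - q^(6*k+1))/(1-q) * q^(2*k) * (qpoch (q^2) (q^4) k / qpoch (q^4) (q^4) k)"
  using prod_factor_qpoch[of q 4 2 1 k] prod_factor_qpoch[of q 4 4 1 k]
  by (simp add: coef_def qint_def prod_dividef)

lemma wp_swap: "wp q b c D F G k = wp q b c D G F k"
  by (simp add: wp_def mult_ac)

lemma wp_cycle: "wp q b c D F G k = wp q b c F G D k"
  by (simp add: wp_def mult_ac)

text \<open>Here \<open>a = q\<close>. The choice \<open>1/q\<close> of the last parameter makes its
  denominator symbol equal to \<open>qpoch q (q^2) k\<close>, which cancels the numerator symbol of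
  \<open>a\<close>; the parameters \<open>1/y\<close> and \<open>y\<close> together leave the factor
  \<open>qpoch (q^2) (q^4) k\<close> of \<open>coef\<close>.\<close>

lemma wp_eq_term:
  assumes "q \<noteq> 0" "q \<noteq> 1" "x \<noteq> 0" "y \<noteq> 0" and nz: "qpoch q (q^2) k \<noteq> 0"
  shows "wp (q^2) (q*x) (q/x) (1/y) y (1/q) k
    = (1-q) * (coef k q * facA k q (2 - x - 1/x) * facB k q (2 - y - 1/y))"
proof -
  have A: "facA k q (2 - x - 1/x) = qpoch (q*x) (q^2) k * qpoch (q/x) (q^2) k / (qpoch (q^4*x) (q^4) k * qpoch (q^4/x) (q^4) k)"
    using quad_ratio_qpoch[OF \<open>x \<noteq> 0\<close>, of 2 1 4 4 k q] by simp
  have B: "facB k q (2 - y - 1/y) = qpoch (q*y) (q^4) k * qpoch (q/y) (q^4) k / (qpoch (q^2*y) (q^2) k * qpoch (q^2/y) (q^2) k)"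
    using quad_ratio_qpoch[OF \<open>y \<noteq> 0\<close>, of 4 1 2 2 k q] by simp
  have e: "q^2*(1/y)*y*(1/q) = q" "q^2*(1/y)*y = q^2" "q^2*(1/y)*(1/q) = q/y" "q^2*y*(1/q) = q*y" "(q^2)^2 = q^4"
    "q*q^2*(q*x) = q^4*x" "q*q^2*(q/x) = q^4/x" "q^2*(1/y) = q^2/y" "q^2*(1/q) = q"
    using assms by (simp_all add: eval_nat_numeral)
  have e': "q * (q^2)^(3*k) = q^(6*k+1)" "(q^2)^k = q^(2*k)"
    by (simp_all flip: power_mult)
  have "wp (q^2) (q*x) (q/x) (1/y) y (1/q) k =
    (1 - q^(6*k+1)) * qpoch q (q^2) k * qpoch (q*x) (q^2) k * qpoch (q/x) (q^2) k *
     qpoch (q*y) (q^4) k * qpoch (q/y) (q^4) k * qpoch (q^2) (q^4) k * q^(2*k) /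
    (qpoch (q^4) (q^4) k * qpoch (q^4/x) (q^4) k * qpoch (q^4*x) (q^4) k *
     qpoch (q^2/y) (q^2) k * qpoch (q^2*y) (q^2) k * qpoch q (q^2) k)"
    unfolding wp_def using e e' by (simp only:)
  then show ?thesis
    using nz \<open>q \<noteq> 1\<close> unfolding coef_qpoch A B by (simp add: mult_ac)
qed

section \<open>Values of the deformed sum at the terminating parameters\<close>

lemma power_inj_of_norm_less_1:
  fixes q :: complex
  assumes "q \<noteq> 0" "norm q < 1"
  shows "q ^ i = q ^ j \<longleftrightarrow> i = j"
proof
  assume "q ^ i = q ^ j"
  then have "norm q ^ i = norm q ^ j" by (metis norm_power)
  then show "i = j"
    using assms power_strict_decreasing[of i j "norm q"] power_strict_decreasing[of j i "norm q"]
    by (cases i j rule: linorder_cases) auto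
qed simp

lemma power_ne_1_of_norm_less_1:
  fixes q :: complex
  assumes "q \<noteq> 0" "norm q < 1" "j > 0"
  shows "q ^ j \<noteq> 1"
  using power_inj_of_norm_less_1[OF assms(1,2), of j 0] assms(3) by simp

lemma deformed_sum_at_Y:
  fixes q x :: complex
  assumes q: "q \<noteq> 0" "norm q < 1" and "x \<noteq> 0"
    and x: "\<And>j. q^(4*j+4) \<noteq> x" "\<And>j. q^(4*j+4) * x \<noteq> 1" and "N < n"
  shows "deformed_sum n q (2 - x - 1/x) (2 - q^(4*N+1) - 1/q^(4*N+1))
    = qint q (4*N+1) * facW N q (2 - x - 1/x)"
proof -
  note inj = power_inj_of_norm_less_1[OF q] and ne1 = power_ne_1_of_norm_less_1[OF q]
  define y where "y = 1/q^(4*N+1)"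
  have y: "y \<noteq> 0" "2 - q^(4*N+1) - 1/q^(4*N+1) = 2 - y - 1/y" "q^(4*N+1) = 1/y"
    using q by (simp_all add: y_def)
  have "q \<noteq> 1" using q by auto
  have nz: "qpoch q (q^2) k \<noteq> 0" for k
    unfolding qpoch_eq_0_iff using ne1 by (simp flip: power_mult power_Suc)
  have "deformed_sum n q (2 - x - 1/x) (2 - y - 1/y)
    = (\<Sum>k\<le>N. coef k q * facA k q (2 - x - 1/x) * facB k q (2 - y - 1/y))"
    unfolding deformed_sum_def
  proof (rule sum.mono_neutral_right)
    have *: "quad (q^(4*N+1)) (2 - y - 1/y) = 0"
      using quad_factor[of y "q^(4*N+1)"] y by simp
    then have "facB k q (2 - y - 1/y) = 0" if "k > N" for k
      unfolding quad_ratio_def using that * by (subst prod_zero_iff) auto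
    then show "\<forall>k\<in>{..<n} - {..N}. coef k q * facA k q (2 - x - 1/x) * facB k q (2 - y - 1/y) = 0"
      by simp
  qed (use \<open>N < n\<close> in auto)
  then have "(1-q) * deformed_sum n q (2 - x - 1/x) (2 - y - 1/y)
    = (\<Sum>k\<le>N. wp (q^2) (q*x) (q/x) (1/y) y (1/q) k)"
    using wp_eq_term[OF q(1) \<open>q \<noteq> 1\<close> \<open>x \<noteq> 0\<close> y(1) nz] by (simp add: sum_distrib_left)
  \<comment> \<open>This is the quadratic summation in base \<open>q^2\<close> with
    \<open>a = q\<close> and \<open>f = q^2\<close>; the parameter \<open>y\<close> plays the
    terminating role, which requires exchanging the last two.\<close>
  also have "\<dots> = (\<Sum>k\<le>N. wp (q^2) (q*x) (q/x) (q * (q^2)^(2*N)) (q/q^2) (q^2/(q*(q^2)^(2*N+1))) k)"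
  proof -
    have "1/y = q * (q^2)^(2*N)" "y = q^2/(q*(q^2)^(2*N+1))" "1/q = q/q^2"
      using q by (simp_all add: y_def power_add flip: power_mult) (simp_all add: power2_eq_square)
    then show ?thesis using wp_swap by metis
  qed
  also have "\<dots> = (1 - q) * (qpoch (q*q^2) (q^2) (2*N) * qpoch (q*q^2*(q/x)/q^2) ((q^2)^2) N * qpoch (q*q^2*(q*x)/q^2) ((q^2)^2) N /
       (qpoch (q*q^2/q^2) (q^2) (2*N) * qpoch (q*q^2*(q/x)) ((q^2)^2) N * qpoch (q*q^2*(q*x)) ((q^2)^2) N))"
  proof (rule wp_quadratic_sum)
    show "(q\<^sup>2) ^ Suc j \<noteq> 1" "q * (q\<^sup>2) ^ Suc j \<noteq> 1" for j
      using ne1 by (simp_all flip: power_mult power_Suc power_add)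
    show "q * (q/x) * (q^2)^(2*j+1) \<noteq> 1" for j
      using x(1)[of j] \<open>x \<noteq> 0\<close> by (simp add: power_add power_mult[symmetric] eval_nat_numeral field_simps)
    show "q * (q*x) * (q^2)^(2*j+1) \<noteq> 1" for j
    proof -
      have "q * (q*x) * (q^2)^(2*j+1) = q^(4*j+4) * x"
      proof -
        have "4*j+4 = 2+2*(2*j+1)" by simp
        then have "q^(4*j+4) = q^2 * (q^2)^(2*j+1)" by (simp only: power_add power_mult simp_thms)
        then show ?thesis by (simp only: power2_eq_square mult_ac)
      qed
      then show ?thesis using x(2)[of j] by (simp only: not_False_eq_True)
    qed
    have "q^(2+2*i) \<noteq> q^(1+2*j)" for i j unfolding inj by presburger
    then show "q^2*(q^2)^i \<noteq> q*(q^2)^j" for i j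
      by (simp only: power_add power_mult power_one_right simp_thms)
    have "q^(2+2*Suc j) \<noteq> q^2" for j unfolding inj by simp
    then show "q^2*(q^2)^Suc j \<noteq> q^2" for j
      by (simp only: power_add power_mult simp_thms)
  qed (use q \<open>x \<noteq> 0\<close> in \<open>auto simp: power2_eq_square\<close>)
  also have "\<dots> = (1-q) * (qint q (4*N+1) * facW N q (2 - x - 1/x))"
  proof -
    have W: "facW N q (2 - x - 1/x) = qpoch (q^2*x) (q^4) N * qpoch (q^2/x) (q^4) N / (qpoch (q^4*x) (q^4) N * qpoch (q^4/x) (q^4) N)"
      using quad_ratio_qpoch[OF \<open>x \<noteq> 0\<close>, of 4 2 4 4 N q] by simp
    have e: "(q^2)^2 = q^4" "q^4/x/q^2 = q^2/x" "q^4*x/q^2 = q^2*x" "q*q^2/q^2 = q"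
      "q*q^2*(q/x) = q^4/x" "q*q^2*(q*x) = q^4*x"
      using q by (simp_all add: eval_nat_numeral)
    \<comment> \<open>Because \<open>f\<close> equals the base, the two products of length
      \<open>2*N\<close> differ by one shift and their quotient collapses to a
      \<open>q\<close>-integer.\<close>
    have "(1 - q) * qpoch (q^2*q) (q^2) (2*N) = qpoch q (q^2) (2*N) * (1 - q^(4*N+1))"
      using qpoch_shift[of q "q^2" "2*N"] by (simp flip: power_mult)
    then have "qpoch (q*q^2) (q^2) (2*N) / qpoch q (q^2) (2*N) = qint q (4*N+1)"
      using nz \<open>q \<noteq> 1\<close> by (simp add: qint_def field_simps)
    then have "qint q (4*N+1) = qpoch (q*q^2) (q^2) (2*N) / qpoch q (q^2) (2*N)" ..
    then show ?thesis unfolding W e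
      by (simp only: times_divide_times_eq mult_ac)
  qed
  finally show ?thesis unfolding y(2) using \<open>q \<noteq> 1\<close> by simp
qed

text \<open>For \<open>x = q^(-n)\<close> the parameter \<open>q*x\<close> is
  \<open>q^(-2*(2*m+1))\<close>: the residue of \<open>n\<close> modulo 4 is what makes the
  terminating index \<open>2*m+1\<close> odd, as \<open>wp_sum_eq_0\<close> demands. The value
  \<open>Y = 0\<close> is \<open>y = 1\<close>.\<close>

lemma deformed_sum_at_X:
  fixes q :: complex
  assumes q: "q \<noteq> 0" "norm q < 1" and n: "n = 4*m+3"
  shows "deformed_sum n q (2 - q^n - 1/q^n) 0 = 0"
proof -
  note ne1 = power_ne_1_of_norm_less_1[OF q]
  define x where "x = 1/q^n"
  have x: "x \<noteq> 0" "2 - q^n - 1/q^n = 2 - x - 1/x" "q^n = 1/x"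
    using q by (simp_all add: x_def)
  have "q \<noteq> 1" using q by auto
  have nz: "qpoch q (q^2) k \<noteq> 0" for k
    unfolding qpoch_eq_0_iff using ne1 by (simp flip: power_mult power_Suc)
  have "deformed_sum n q (2 - x - 1/x) 0
    = (\<Sum>k<2*m+2. coef k q * facA k q (2 - x - 1/x) * facB k q 0)"
    unfolding deformed_sum_def
  proof (rule sum.mono_neutral_right)
    have *: "quad (q^(2*(2*m+1)+1)) (2 - x - 1/x) = 0"
    proof -
      have "2*(2*m+1)+1 = n" by (simp add: n)
      then show ?thesis using quad_factor[of x "q^n"] x by simp
    qed
    then have "facA k q (2 - x - 1/x) = 0" if "k > 2*m+1" for k
      unfolding quad_ratio_def using that *
      by (intro prod_zero bexI[of _ "2*m+1"]) (simp_all only: finite_lessThan div_0 lessThan_iff)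
    then show "\<forall>k\<in>{..<n} - {..<2*m+2}. coef k q * facA k q (2 - x - 1/x) * facB k q 0 = 0"
      by simp
  qed (auto simp: n)
  then have "(1-q) * deformed_sum n q (2 - x - 1/x) 0
    = (\<Sum>k<2*m+2. wp (q^2) (q*x) (q/x) (1/1) 1 (1/q) k)"
  proof -
    have "wp (q^2) (q*x) (q/x) (1/1) 1 (1/q) k = (1-q) * (coef k q * facA k q (2 - x - 1/x) * facB k q 0)" for k
      using wp_eq_term[OF q(1) \<open>q \<noteq> 1\<close> x(1) one_neq_zero nz, of k] by simp
    then show ?thesis
      by (simp only: \<open>deformed_sum n q (2 - x - 1/x) 0 = _\<close> sum_distrib_left)
  qed
  also have "\<dots> = (\<Sum>k<2*m+2. wp (q^2) (1/q^(2*(2*m+1))) (q^(4*m+4)) 1 1 (1/q) k)"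
  proof -
    have "q*x = 1/q^(2*(2*m+1))" "q/x = q^(4*m+4)" "(1::complex)/1 = 1"
      using q by (simp_all add: x_def n power_add eval_nat_numeral)
    then show ?thesis by (simp only:)
  qed
  also have "\<dots> = 0"
    using ne1 q by (intro wp_sum_eq_0) (simp_all del: power_Suc)
  finally show ?thesis unfolding x(2) using \<open>q \<noteq> 1\<close> by simp
qed

subsection \<open>The deformed sum at roots of unity of odd order\<close>

text \<open>Approach from inside the punctured disc, where the conditions of the summation formulas
  can be checked by comparing norms.\<close>

abbreviation disc_at :: "complex \<Rightarrow> complex filter"
  where "disc_at \<zeta> \<equiv> at \<zeta> within (ball 0 1 - {0})"

lemma disc_at_neq_bot:
  assumes "norm \<zeta> = 1"
  shows "disc_at \<zeta> \<noteq> bot"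
proof -
  have "\<zeta> islimpt ball 0 1" using assms by (simp add: islimpt_ball)
  then have "\<zeta> islimpt (ball 0 1 - {0})"
    by (metis islimpt_insert insert_Diff_single)
  then show ?thesis by (simp add: trivial_limit_within)
qed

lemma eventually_disc_at: "eventually (\<lambda>q. q \<noteq> 0 \<and> norm q < 1) (disc_at \<zeta>)"
  by (auto simp: eventually_at_filter)

lemma tendsto_qpoch [tendsto_intros]:
  fixes f g :: "_ \<Rightarrow> 'a::{comm_ring_1,real_normed_algebra_1}"
  assumes "(f \<longlongrightarrow> x) F" "(g \<longlongrightarrow> q) F"
  shows "((\<lambda>t. qpoch (f t) (g t) k) \<longlongrightarrow> qpoch x q k) F"
  unfolding qpoch_def by (intro tendsto_intros assms)

lemma tendsto_wp:
  assumes "(q \<longlongrightarrow> q0) M" "(b \<longlongrightarrow> b0) M" "(c \<longlongrightarrow> c0) M"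
    "(d \<longlongrightarrow> d0) M" "(f \<longlongrightarrow> f0) M" "(g \<longlongrightarrow> g0) M"
    and nz: "qpoch (q0^2) (q0^2) k \<noteq> 0" "qpoch (q0*d0*f0*g0*q0*c0) (q0^2) k \<noteq> 0"
     "qpoch (q0*d0*f0*g0*q0*b0) (q0^2) k \<noteq> 0"
     "qpoch (q0*d0) q0 k \<noteq> 0" "qpoch (q0*f0) q0 k \<noteq> 0" "qpoch (q0*g0) q0 k \<noteq> 0"
  shows "((\<lambda>t. wp (q t) (b t) (c t) (d t) (f t) (g t) k) \<longlongrightarrow> wp q0 b0 c0 d0 f0 g0 k) M"
  unfolding wp_def by (intro tendsto_intros assms) (use nz in simp)

text \<open>Oddness of the order \<open>d\<close> ensures that \<open>\<zeta>^2\<close> and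
  \<open>\<zeta>^4\<close> have order \<open>d\<close> too, so factors in all three bases vanish
  with the same period.\<close>

locale odd_root =
  fixes \<zeta> :: complex and d :: nat
  assumes root: "\<zeta> ^ j = 1 \<longleftrightarrow> d dvd j" and odd_d: "odd d" and d_gt_1: "d > 1"
begin

lemma root_ne_1: "\<zeta> \<noteq> 1"
  using root[of 1] d_gt_1 by auto

lemma root_ne_0: "\<zeta> \<noteq> 0"
  using root[of d] d_gt_1 by (auto simp: power_0_left)

lemma norm_root: "norm \<zeta> = 1"
proof -
  have "norm \<zeta> ^ d = 1" using root[of d] by (metis dvd_refl norm_one norm_power)
  then show ?thesis using power_eq_imp_eq_base[of "norm \<zeta>" d 1] d_gt_1 by simp
qed

lemma dvd_pow2_mult: "d dvd 2^i * j \<longleftrightarrow> d dvd j"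
  using odd_d by (simp add: coprime_dvd_mult_right_iff)

lemma denominators_ne_1:
  assumes "j + 1 < d"
  shows "\<zeta> ^ (4*j+4) \<noteq> 1" "\<zeta> ^ (2*j+2) \<noteq> 1"
proof -
  have "\<not> d dvd j + 1" using assms by (auto dest: dvd_imp_le)
  moreover have "4*j+4 = 2^2*(j+1)" "2*j+2 = 2^1*(j+1)" by simp_all
  ultimately show "\<zeta> ^ (4*j+4) \<noteq> 1" "\<zeta> ^ (2*j+2) \<noteq> 1"
    unfolding root by (simp_all only: dvd_pow2_mult simp_thms)
qed

text \<open>
  The case \<open>N = (d - 1) / 2\<close> of the quadratic summation, whose closed form contains the factor
  \<open>1 - q^d\<close>, in the limit \<open>q \<longlonglongrightarrow> \<zeta>\<close>.
\<close>

lemma deformed_sum_root_of_unity: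
  fixes x y :: complex
  assumes x: "norm x = 1" "x ^ d \<noteq> 1" and y: "norm y = 1" "y ^ d \<noteq> 1"
  shows "deformed_sum d \<zeta> (2 - x - 1/x) (2 - y - 1/y) = 0"
proof -
  note \<zeta> = root and d = odd_d d_gt_1 and \<zeta>1 = norm_root and \<zeta>0 = root_ne_0 and \<zeta>ne1 = root_ne_1
  obtain N where N: "d = 2*N+1" using d(1) oddE by blast
  have N0: "N > 0" using N d by simp
  have \<zeta>d: "\<zeta> ^ d = 1" using \<zeta> by simp
  have xy0: "x \<noteq> 0" "y \<noteq> 0" using x y by auto
  have ne: "\<zeta> ^ j \<noteq> z" if "z ^ d \<noteq> 1" for z j
    using that \<zeta>d by (metis power_mult mult.commute power_one)
  have ne': "\<zeta> ^ j * z \<noteq> 1" if "z ^ d \<noteq> 1" for z j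
    using that \<zeta>d by (metis power_mult_distrib power_mult mult.commute power_one mult_1)
  have y1: "y \<noteq> 1" using y by auto
  \<comment> \<open>Base \<open>q^2\<close>, \<open>a = q\<close> and \<open>f = q*y\<close>. Since
    \<open>4*N+2 = 2*d\<close>, the last three parameters tend to \<open>1/\<zeta>\<close>,
    \<open>1/y\<close> and \<open>y\<close>, a cyclic permutation of those in
    \<open>wp_eq_term\<close>; thus \<open>y\<close> stays free, and termination comes from the
    order of \<open>\<zeta>\<close>.\<close>
  define L where "L q = (\<Sum>k\<le>N. wp (q^2) (q*x) (q/x) (q*(q^2)^(2*N)) (q/(q*y)) (q*y/(q*(q^2)^(2*N+1))) k)" for q
  define R where "R q = (1 - q) * (qpoch (q*q^2) (q^2) (2*N) * qpoch (q*q^2*(q/x)/(q*y)) ((q^2)^2) N * qpoch (q*q^2*(q*x)/(q*y)) ((q^2)^2) N /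
       (qpoch (q*q^2/(q*y)) (q^2) (2*N) * qpoch (q*q^2*(q/x)) ((q^2)^2) N * qpoch (q*q^2*(q*x)) ((q^2)^2) N))" for q
  have LR: "L q = R q" if q: "q \<noteq> 0" "norm q < 1" for q
    unfolding L_def R_def
  proof (rule wp_quadratic_sum)
    note inj = power_inj_of_norm_less_1[OF q] and ne1 = power_ne_1_of_norm_less_1[OF q]
    have lt: "norm q ^ j < 1" if "j > 0" for j
      using that q by (simp add: power_less_one_iff)
    \<comment> \<open>The parameters lie on the unit circle, so the norm alone separates
      \<open>q^i * y\<close> from \<open>q^j\<close> for \<open>i \<noteq> j\<close>.\<close>
    have n1: "q ^ j * z \<noteq> 1" if "j > 0" "norm z = 1" for j z
    proof
      assume "q ^ j * z = 1"
      then have "norm (q ^ j * z) = 1" by simp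
      then show False using lt[OF that(1)] that(2) by (simp add: norm_mult norm_power)
    qed
    have n2: "q ^ i * z \<noteq> q ^ j" if "i \<noteq> j" "norm z = 1" for i j z
    proof
      assume "q ^ i * z = q ^ j"
      then have "of_real (norm q) ^ i = (of_real (norm q) ^ j :: complex)"
        using that(2) by (metis norm_mult norm_power mult.right_neutral of_real_power)
      then show False
        using that(1) power_inj_of_norm_less_1[of "of_real (norm q)" i j] q by simp
    qed
    show "(q\<^sup>2) ^ Suc j \<noteq> 1" "q * (q\<^sup>2) ^ Suc j \<noteq> 1" for j
      using ne1 by (simp_all flip: power_mult power_Suc power_add)
    have e: "q^(4*j+4) = q * q * (q^2)^(2*j+1)" for j
    proof -
      have "4*j+4 = 2+2*(2*j+1)" by simp
      then have "q^(4*j+4) = q^2 * (q^2)^(2*j+1)" by (simp only: power_add power_mult)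
      then show ?thesis by (simp only: power2_eq_square)
    qed
    show "q * (q/x) * (q^2)^(2*j+1) \<noteq> 1" for j
      using n1[of "4*j+4" "1/x"] x(1) unfolding e by (simp add: norm_divide)
    show "q * (q*x) * (q^2)^(2*j+1) \<noteq> 1" for j
      using n1[of "4*j+4" x] x(1) unfolding e by (simp add: mult_ac)
    show "q*y*(q^2)^i \<noteq> q*(q^2)^j" for i j
    proof (cases "i = j")
      case True
      then show ?thesis using q y1 by simp
    next
      case False
      then have "q^(1+2*i) * y \<noteq> q^(1+2*j)" using y(1) by (intro n2) auto
      then show ?thesis unfolding power_add power_mult by (simp only: power_one_right mult_ac simp_thms)
    qed
    have "q^(2+2*Suc j) \<noteq> q * y" for j
      using n2[of 1 "2+2*Suc j" y] y(1) by (auto simp del: power_Suc add_2_eq_Suc dest: sym)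
    then show "q^2*(q^2)^Suc j \<noteq> q*y" for j
      by (simp only: power_add power_mult simp_thms)
  qed (use q xy0 in \<open>auto simp: power2_eq_square\<close>)
  have id: "((\<lambda>q. q) \<longlongrightarrow> \<zeta>) (disc_at \<zeta>)" by (rule tendsto_ident_at)
  have p4: "\<zeta>^(4*N+2) = 1" "\<zeta>^(4*N+3) = \<zeta>"
  proof -
    show *: "\<zeta>^(4*N+2) = 1" unfolding \<zeta> N by (auto intro: dvdI[of _ _ 2])
    show "\<zeta>^(4*N+3) = \<zeta>" using * by (simp add: power_add eval_nat_numeral mult_ac)
  qed
  have arg: "\<zeta>*(\<zeta>^2)^(2*N) = 1/\<zeta>" "\<zeta>/(\<zeta>*y) = 1/y" "\<zeta>*y/(\<zeta>*(\<zeta>^2)^(2*N+1)) = y"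
    using p4 \<zeta>0 by (simp_all add: field_simps power_add flip: power_mult) (simp_all add: eval_nat_numeral mult.assoc)
  have a: "\<zeta>^2*(1/\<zeta>)*(1/y)*y*\<zeta>^2 = \<zeta>^3"
    using \<zeta>0 xy0 by (simp add: eval_nat_numeral)
  have e: "(\<zeta>^2)^j = \<zeta>^(2*j)" "((\<zeta>^2)^2)^j = \<zeta>^(4*j)" "((\<zeta>^2)^2) = \<zeta>^4" for j
    by (simp_all flip: power_mult)
  have aux: "\<zeta>^i/z*\<zeta>^j \<noteq> 1" "\<zeta>^i*z*\<zeta>^j \<noteq> 1" if "z ^ d \<noteq> 1" "z \<noteq> 0" for i j z
    using ne[OF that(1), of "i+j"] ne'[OF that(1), of "i+j"] that(2)
    by (auto simp: power_add mult_ac divide_simps)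
  have nzx: "qpoch (\<zeta>^i/x) ((\<zeta>^2)^2) k \<noteq> 0" "qpoch (\<zeta>^i*x) ((\<zeta>^2)^2) k \<noteq> 0" for i k
    unfolding qpoch_eq_0_iff e(2) using aux[OF x(2)] xy0 by blast+
  have nzy: "qpoch (\<zeta>^i/y) (\<zeta>^2) k \<noteq> 0" "qpoch (\<zeta>^i*y) (\<zeta>^2) k \<noteq> 0" for i k
    unfolding qpoch_eq_0_iff e(1) using aux[OF y(2)] xy0 by blast+
  \<comment> \<open>The bound is sharp: the next factor, at \<open>j = N\<close>, is
    \<open>1 - \<zeta>^d = 0\<close>.\<close>
  have nz1: "qpoch \<zeta> (\<zeta>^2) k \<noteq> 0" if "k \<le> N" for k
  proof -
    have "\<zeta>*(\<zeta>^2)^j \<noteq> 1" if "j < N" for j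
    proof -
      have "\<zeta>^Suc (2*j) \<noteq> 1" unfolding \<zeta> using that by (auto simp: N dest: dvd_imp_le)
      then show ?thesis by (simp add: e(1))
    qed
    then show ?thesis using that by (auto simp: qpoch_eq_0_iff)
  qed
  have x43: "\<zeta>^3*(\<zeta>/x) = \<zeta>^4/x" "\<zeta>^3*(\<zeta>*x) = \<zeta>^4*x" "\<zeta>*\<zeta>^2*(\<zeta>/x) = \<zeta>^4/x" "\<zeta>*\<zeta>^2*(\<zeta>*x) = \<zeta>^4*x"
    "\<zeta>*\<zeta>^2/(\<zeta>*y) = \<zeta>^2/y" "\<zeta>^2*(1/y) = \<zeta>^2/y" "\<zeta>^2*(1/\<zeta>) = \<zeta>"
    using \<zeta>0 by (simp_all add: eval_nat_numeral)
  have Llim: "(L \<longlongrightarrow> (\<Sum>k\<le>N. wp (\<zeta>^2) (\<zeta>*x) (\<zeta>/x) (1/\<zeta>) (1/y) y k)) (disc_at \<zeta>)"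
    unfolding L_def
  proof (intro tendsto_sum tendsto_wp)
    fix k assume k: "k \<in> {..N}"
    show "((\<lambda>q. q*(q^2)^(2*N)) \<longlongrightarrow> 1/\<zeta>) (disc_at \<zeta>)"
      unfolding arg[symmetric] by (intro tendsto_intros id)
    show "((\<lambda>q. q/(q*y)) \<longlongrightarrow> 1/y) (disc_at \<zeta>)"
      unfolding arg(2)[symmetric] by (intro tendsto_intros id) (use \<zeta>0 xy0 in auto)
    have "((\<lambda>q. q*y/(q*(q^2)^(2*N+1))) \<longlongrightarrow> \<zeta>*y/(\<zeta>*(\<zeta>^2)^(2*N+1))) (disc_at \<zeta>)"
      by (intro tendsto_intros id) (use \<zeta>0 xy0 in auto)
    then show "((\<lambda>q. q*y/(q*(q^2)^(2*N+1))) \<longlongrightarrow> y) (disc_at \<zeta>)"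
      unfolding arg(3) .
    show "qpoch ((\<zeta>^2)^2) ((\<zeta>^2)^2) k \<noteq> 0"
    proof -
      have "\<zeta>^4*\<zeta>^(4*j) \<noteq> 1" if "j < k" for j
      proof -
        have "\<zeta>^(2^2*Suc j) \<noteq> 1" unfolding \<zeta> dvd_pow2_mult using that k by (auto simp: N dest: dvd_imp_le)
        then show ?thesis by (simp add: power_add)
      qed
      then show ?thesis unfolding qpoch_eq_0_iff e(2) unfolding e(3) by auto
    qed
    show "qpoch (\<zeta>^2*(1/\<zeta>)*(1/y)*y*\<zeta>^2*(\<zeta>/x)) ((\<zeta>^2)^2) k \<noteq> 0" unfolding a unfolding x43 by (rule nzx)
    show "qpoch (\<zeta>^2*(1/\<zeta>)*(1/y)*y*\<zeta>^2*(\<zeta>*x)) ((\<zeta>^2)^2) k \<noteq> 0" unfolding a unfolding x43 by (rule nzx)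
    show "qpoch (\<zeta>^2*(1/\<zeta>)) (\<zeta>^2) k \<noteq> 0" unfolding x43 using k by (intro nz1) auto
    show "qpoch (\<zeta>^2*(1/y)) (\<zeta>^2) k \<noteq> 0" unfolding x43 by (rule nzy)
    show "qpoch (\<zeta>^2*y) (\<zeta>^2) k \<noteq> 0" by (rule nzy)
  qed (use xy0 in \<open>auto intro!: tendsto_intros id\<close>)
  have Rlim: "(R \<longlongrightarrow> R \<zeta>) (disc_at \<zeta>)"
    unfolding R_def
    by (intro tendsto_intros id no_zero_divisors) (use \<zeta>0 xy0 in \<open>simp_all only: x43 nzx nzy mult_eq_0_iff simp_thms\<close>)
  have R0: "R \<zeta> = 0"
  proof -
    \<comment> \<open>The index \<open>N-1\<close> gives the exponent
      \<open>3 + 2*(N-1) = d\<close>, hence a zero factor in the numerator of the closed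
      form.\<close>
    have "\<zeta>*\<zeta>^2*(\<zeta>^2)^(N-1) = \<zeta>^(1+2+2*(N-1))" by (simp only: power_add power_mult power_one_right)
    also have "1+2+2*(N-1) = d" using N N0 by simp
    finally have "qpoch (\<zeta>*\<zeta>^2) (\<zeta>^2) (2*N) = 0"
      unfolding qpoch_eq_0_iff using \<zeta>d N0 by (intro exI[of _ "N-1"]) auto
    then show ?thesis by (simp add: R_def)
  qed
  have "eventually (\<lambda>q. R q = L q) (disc_at \<zeta>)"
    using eventually_disc_at by eventually_elim (use LR in auto)
  then have "(L \<longlongrightarrow> 0) (disc_at \<zeta>)"
    using Rlim unfolding R0 by (rule Lim_transform_eventually[rotated])
  then have S0: "(\<Sum>k\<le>N. wp (\<zeta>^2) (\<zeta>*x) (\<zeta>/x) (1/\<zeta>) (1/y) y k) = 0"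
    using tendsto_unique[OF disc_at_neq_bot[OF \<zeta>1] Llim] by blast
  have "wp (\<zeta>^2) (\<zeta>*x) (\<zeta>/x) (1/\<zeta>) (1/y) y k = (1-\<zeta>) * (coef k \<zeta> * facA k \<zeta> (2-x-1/x) * facB k \<zeta> (2-y-1/y))" if "k \<le> N" for k
    using wp_eq_term[OF \<zeta>0 \<zeta>ne1 xy0 nz1[OF that]] wp_cycle[of "\<zeta>^2" "\<zeta>*x" "\<zeta>/x" "1/\<zeta>" "1/y" y k] by (simp only:)
  then have "(1-\<zeta>) * (\<Sum>k\<le>N. coef k \<zeta> * facA k \<zeta> (2-x-1/x) * facB k \<zeta> (2-y-1/y)) = 0"
    using S0 by (simp add: sum_distrib_left del: One_nat_def)
  then have "(\<Sum>k\<le>N. coef k \<zeta> * facA k \<zeta> (2-x-1/x) * facB k \<zeta> (2-y-1/y)) = 0"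
    using \<zeta>ne1 by simp
  moreover have "deformed_sum d \<zeta> (2-x-1/x) (2-y-1/y) = (\<Sum>k\<le>N. coef k \<zeta> * facA k \<zeta> (2-x-1/x) * facB k \<zeta> (2-y-1/y))"
    unfolding deformed_sum_def
  proof (rule sum.mono_neutral_right)
    \<comment> \<open>Terms beyond \<open>N\<close> contain the factor at \<open>j = N\<close>,
      whose exponent \<open>4*N+2\<close> is \<open>2*d\<close>.\<close>
    have "(\<Prod>j<k. (1 - \<zeta>^(4*j+2)) / (1 - \<zeta>^(4*j+4))) = 0" if "k > N" for k
      using that p4 by (intro prod_zero bexI[of _ N]) auto
    then show "\<forall>k\<in>{..<d} - {..N}. coef k \<zeta> * facA k \<zeta> (2-x-1/x) * facB k \<zeta> (2-y-1/y) = 0"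
      by (simp add: coef_def)
  qed (use N in auto)
  ultimately show ?thesis by simp
qed

end

subsection \<open>Deforming the sum near a root of unity\<close>

text \<open>Each factor is affine in \<open>X\<close>, with
  \<open>quad u X = quad u 0 + X * u\<close>; the product rule for differences then builds a
  continuous cofactor.\<close>

lemma prod_quad_difference:
  assumes "finite A"
  shows "\<exists>g. continuous_on UNIV (\<lambda>(q,X). g q X :: complex) \<and>
    (\<forall>q X. (\<Prod>j\<in>A. quad (q ^ e j) X) = (\<Prod>j\<in>A. quad (q ^ e j) 0) + X * g q X)"
  using assms
proof (induction A rule: finite_induct)
  case empty
  show ?case by (rule exI[of _ "\<lambda>_ _. 0"]) simp
next
  case (insert k A)
  then obtain g where g: "continuous_on UNIV (\<lambda>(q,X). g q X)"
    "\<And>q X. (\<Prod>j\<in>A. quad (q ^ e j) X) = (\<Prod>j\<in>A. quad (q ^ e j) 0) + X * g q X"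
    by blast
  define h where "h q X = g q X * quad (q ^ e k) X + (\<Prod>j\<in>A. quad (q ^ e j) 0) * q ^ e k" for q X
  have "continuous_on UNIV (\<lambda>(q,X). h q X)"
    using g(1) unfolding h_def case_prod_unfold quad_def by (intro continuous_intros) auto
  moreover have "(\<Prod>j\<in>insert k A. quad (q ^ e j) X) = (\<Prod>j\<in>insert k A. quad (q ^ e j) 0) + X * h q X" for q X
    unfolding h_def prod.insert[OF insert(1,2)] g(2)[of q X] by (simp add: quad_def algebra_simps)
  ultimately show ?case by blast
qed

text \<open>Numerator and denominator have separate index sets because the closed form is later used
  with one numerator factor taken out.\<close>

lemma quad_quotient_difference:
  fixes \<zeta> :: complex and e e' :: "nat \<Rightarrow> nat"
  assumes fin: "finite A" "finite B" and nz: "\<And>j. j \<in> B \<Longrightarrow> \<zeta> ^ e' j \<noteq> 1"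
  defines "R \<equiv> \<lambda>q X. (\<Prod>j\<in>A. quad (q ^ e j) X) / (\<Prod>j\<in>B. quad (q ^ e' j) X)"
  obtains g where "isCont (\<lambda>(q,X). g q X) (\<zeta>, 0)"
    "eventually (\<lambda>(q,X). R q X = R q 0 + X * g q X) (nhds (\<zeta>, 0))"
proof -
  define P where "P q X = (\<Prod>j\<in>A. quad (q ^ e j) X)" for q X
  define Q where "Q q X = (\<Prod>j\<in>B. quad (q ^ e' j) X)" for q X
  obtain g1 where g1: "continuous_on UNIV (\<lambda>(q,X). g1 q X)" "\<And>q X. P q X = P q 0 + X * g1 q X"
    using prod_quad_difference[OF fin(1), of e] unfolding P_def by blast
  obtain g2 where g2: "continuous_on UNIV (\<lambda>(q,X). g2 q X)" "\<And>q X. Q q X = Q q 0 + X * g2 q X"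
    using prod_quad_difference[OF fin(2), of e'] unfolding Q_def by blast
  define g where "g q X = (g1 q X * Q q 0 - P q 0 * g2 q X) / (Q q 0 * Q q X)" for q X
  have cP: "isCont (\<lambda>(q,X). P q X) p" "isCont (\<lambda>(q,X). P q 0) p" 
    "isCont (\<lambda>(q,X). Q q X) p" "isCont (\<lambda>(q,X). Q q 0) p" for p :: "complex \<times> complex"
    unfolding P_def Q_def quad_def case_prod_unfold by (intro continuous_intros)+
  have cg: "isCont (\<lambda>(q,X). g1 q X) p" "isCont (\<lambda>(q,X). g2 q X) p" for p
    using g1(1) g2(1) continuous_on_eq_continuous_at[OF open_UNIV] by blast+
  have nz: "Q \<zeta> 0 \<noteq> 0"
    using nz fin by (simp add: Q_def)
  have "isCont (\<lambda>(q,X). g q X) (\<zeta>, 0)"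
    unfolding g_def case_prod_unfold
    by (intro continuous_intros cP[unfolded case_prod_unfold] cg[unfolded case_prod_unfold]) (use nz in simp)
  moreover have "eventually (\<lambda>p. Q (fst p) 0 \<noteq> 0 \<and> Q (fst p) (snd p) \<noteq> 0) (nhds (\<zeta>, 0))"
  proof (intro eventually_conj)
    have lim: "((\<lambda>p. Q (fst p) 0) \<longlongrightarrow> Q \<zeta> 0) (nhds (\<zeta>,0::complex))" "((\<lambda>p. Q (fst p) (snd p)) \<longlongrightarrow> Q \<zeta> 0) (nhds (\<zeta>,0))"
      using cP(3,4)[of "(\<zeta>,0)"] by (simp_all add: continuous_at tendsto_nhds_iff case_prod_unfold)
    show "eventually (\<lambda>p. Q (fst p) 0 \<noteq> 0) (nhds (\<zeta>, 0::complex))"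
      by (rule tendsto_imp_eventually_ne[OF lim(1) nz])
    show "eventually (\<lambda>p. Q (fst p) (snd p) \<noteq> 0) (nhds (\<zeta>, 0))"
      by (rule tendsto_imp_eventually_ne[OF lim(2) nz])
  qed
  then have "eventually (\<lambda>(q,X). R q X = R q 0 + X * g q X) (nhds (\<zeta>, 0))"
  proof eventually_elim
    case (elim p)
    obtain q X where p: "p = (q,X)" by fastforce
    have nz: "Q q 0 \<noteq> 0" "Q q X \<noteq> 0" using elim p by auto
    have "P q X / Q q X = P q 0 / Q q 0 + X * g q X"
    proof -
      have "X * g q X = (X * g1 q X * Q q 0 - P q 0 * (X * g2 q X)) / (Q q 0 * Q q X)"
        by (simp add: g_def algebra_simps)
      also have "X * g1 q X = P q X - P q 0" using g1(2)[of q X] by simp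
      also have "X * g2 q X = Q q X - Q q 0" using g2(2)[of q X] by simp
      also have "((P q X - P q 0) * Q q 0 - P q 0 * (Q q X - Q q 0)) / (Q q 0 * Q q X) = P q X / Q q X - P q 0 / Q q 0"
        using nz by (simp add: divide_simps) (simp add: algebra_simps)
      finally show ?thesis by simp
    qed
    then show ?case by (simp add: p R_def P_def Q_def)
  qed
  ultimately show ?thesis using that by blast
qed

lemma quad_ratio_difference:
  fixes \<zeta> :: complex
  assumes "\<And>j. j < k \<Longrightarrow> \<zeta> ^ e' j \<noteq> 1"
  obtains g where "isCont (\<lambda>(q,X). g q X) (\<zeta>, 0)"
    "eventually (\<lambda>(q,X). quad_ratio e e' k q X = quad_ratio e e' k q 0 + X * g q X) (nhds (\<zeta>, 0))"
  using quad_quotient_difference[of "{..<k}" "{..<k}" \<zeta> e' e] assms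
  unfolding quad_ratio_def prod_dividef by auto

lemma isCont_quad_ratio:
  fixes \<zeta> :: complex
  assumes "\<And>j. j < k \<Longrightarrow> \<zeta> ^ e' j \<noteq> 1"
  shows "isCont (\<lambda>X. quad_ratio e e' k \<zeta> X) 0"
  unfolding quad_ratio_def quad_def
  by (intro continuous_intros) (use assms in auto)

lemma one_minus_power_factor:
  fixes \<zeta> :: complex
  assumes "\<zeta> ^ m = 1"
  obtains p where "continuous_on UNIV p" "\<And>q. 1 - q ^ m = (q - \<zeta>) * p q" "m > 0 \<Longrightarrow> p \<zeta> \<noteq> 0"
proof
  define p where "p q = - (\<Sum>i<m. \<zeta> ^ (m - Suc i) * q ^ i)" for q
  show "continuous_on UNIV p" unfolding p_def by (intro continuous_intros)
  have "q ^ m - \<zeta> ^ m = (q - \<zeta>) * (\<Sum>i<m. \<zeta> ^ (m - Suc i) * q ^ i)" for q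
    by (rule power_diff_sumr2)
  then show "1 - q ^ m = (q - \<zeta>) * p q" for q
    using assms by (simp add: p_def algebra_simps)
  assume "m > 0"
  have "(\<Sum>i<m. \<zeta> ^ (m - Suc i) * \<zeta> ^ i) = (\<Sum>i<m. \<zeta> ^ (m - 1))"
    by (intro sum.cong refl) (simp flip: power_add)
  moreover have "\<zeta> \<noteq> 0" using assms \<open>m > 0\<close> by (auto simp: power_0_left)
  ultimately show "p \<zeta> \<noteq> 0" using \<open>m > 0\<close> by (simp add: p_def)
qed

lemma isCont_coef:
  assumes "\<And>j. j < k \<Longrightarrow> \<zeta> ^ (4*j+4) \<noteq> 1" "\<zeta> \<noteq> 1"
  shows "isCont (coef k) \<zeta>"
  unfolding coef_def qint_def by (intro continuous_intros) (use assms in auto)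

context odd_root
begin

text \<open>Used to approach \<open>X = 0\<close> through parameters \<open>x\<close> on the unit circle that are no \<open>d\<close>-th roots of unity.\<close>

definition small :: "real \<Rightarrow> complex"
  where "small t = 2 - cis t - 1 / cis t"

lemma tendsto_small: "(small \<longlongrightarrow> 0) (at_right 0)"
  unfolding small_def by (auto intro!: tendsto_eq_intros simp: cis_neq_zero)

lemma eventually_small: "eventually (\<lambda>t. small t \<noteq> 0 \<and> cis t ^ d \<noteq> 1) (at_right 0)"
proof -
  have "cis t ^ d \<noteq> 1" if "0 < t" "t < 2 * pi / d" for t
  proof
    assume "cis t ^ d = 1"
    then have "cos (d * t) = 1" by (metis Complex.DeMoivre cis.sel(1) one_complex.sel(1))
    then obtain i :: int where i: "d * t = i * 2 * pi" by (auto simp: cos_one_2pi_int)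
    have "0 < d * t" "d * t < 2 * pi" using that d_gt_1 by (simp_all add: field_simps)
    then have "0 < i" "i < 1" unfolding i by (simp_all add: zero_less_mult_iff)
    then show False by simp
  qed
  moreover have "eventually (\<lambda>t::real. 0 < t \<and> t < 2 * pi / d) (at_right 0)"
    using eventually_at_right_real[of 0 "2 * pi / d"] d_gt_1 by simp
  moreover have "small t \<noteq> 0" if "cis t ^ d \<noteq> 1" for t
  proof -
    have "small t * cis t = - ((1 - cis t) ^ 2)"
      by (simp add: small_def field_simps power2_eq_square cis_neq_zero)
    then show ?thesis using that by (auto simp: cis_neq_zero)
  qed
  ultimately show ?thesis by (auto elim: eventually_mono)
qed

text \<open>\<open>deformed_sum_root_of_unity\<close> excludes \<open>x = 1\<close> and
  \<open>y = 1\<close>, that is \<open>X = 0\<close> and \<open>Y = 0\<close>. These are recovered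
  one variable at a time by continuity, as the denominators of the terms with \<open>k < d\<close>
  do not vanish at \<open>\<zeta>\<close>.\<close>

lemma deformed_sum_small:
  "eventually (\<lambda>t. deformed_sum d \<zeta> (small t) (small t) = 0 \<and> deformed_sum d \<zeta> (small t) 0 = 0 \<and>
    deformed_sum d \<zeta> 0 (small t) = 0) (at_right 0)"
  and deformed_sum_0: "deformed_sum d \<zeta> 0 0 = 0"
proof -
  have ss: "deformed_sum d \<zeta> (small t) (small s) = 0" if "cis t ^ d \<noteq> 1" "cis s ^ d \<noteq> 1" for s t
    unfolding small_def using that by (intro deformed_sum_root_of_unity) auto
  have contA: "isCont (\<lambda>X. facA k \<zeta> X) 0" if "k < d" for k
    by (rule isCont_quad_ratio) (use that denominators_ne_1 in auto)
  have contB: "isCont (\<lambda>X. facB k \<zeta> X) 0" if "k < d" for k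
    by (rule isCont_quad_ratio) (use that denominators_ne_1 in auto)
  have X: "((\<lambda>t. deformed_sum d \<zeta> (small t) Y) \<longlongrightarrow> deformed_sum d \<zeta> 0 Y) (at_right 0)" for Y
    unfolding deformed_sum_def
    by (intro tendsto_intros isCont_tendsto_compose[OF contA] tendsto_small) auto
  have Y: "((\<lambda>t. deformed_sum d \<zeta> X (small t)) \<longlongrightarrow> deformed_sum d \<zeta> X 0) (at_right 0)" for X
    unfolding deformed_sum_def
    by (intro tendsto_intros isCont_tendsto_compose[OF contB] tendsto_small) auto
  have lim: "z = 0" if "(f \<longlongrightarrow> z) (at_right (0::real))" "eventually (\<lambda>t. f t = 0) (at_right 0)" for f and z :: complex
    using tendsto_unique[OF _ that(1)] tendsto_eventually[OF that(2)] by simp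
  have s0: "deformed_sum d \<zeta> (small t) 0 = 0" if "cis t ^ d \<noteq> 1" for t
    by (rule lim[OF Y eventually_mono[OF eventually_small]]) (use ss that in blast)
  have 0: "deformed_sum d \<zeta> 0 (small t) = 0" if "cis t ^ d \<noteq> 1" for t
    by (rule lim[OF X eventually_mono[OF eventually_small]]) (use ss that in blast)
  show "eventually (\<lambda>t. deformed_sum d \<zeta> (small t) (small t) = 0 \<and> deformed_sum d \<zeta> (small t) 0 = 0 \<and>
    deformed_sum d \<zeta> 0 (small t) = 0) (at_right 0)"
    using eventually_small by eventually_elim (auto intro: ss s0 0)
  show "deformed_sum d \<zeta> 0 0 = 0"
    by (rule lim[OF X eventually_mono[OF eventually_small]]) (use s0 in blast)
qed

text \<open>
  The summand is a product of a function of \<open>X\<close> and a function of \<open>Y\<close>, so that the double difference is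
  divisible by \<open>X * Y\<close>; the cofactor vanishes at \<open>(\<zeta>,0,0)\<close> because the sum vanishes identically at
  \<open>q = \<zeta>\<close>. With \<open>X\<close> and \<open>Y\<close> of order \<open>(q - \<zeta>)^2\<close> this gives one order more than the obvious four.
\<close>

lemma double_difference:
  obtains H where "isCont (\<lambda>(q,X,Y). H q X Y) (\<zeta>,0,0)" "H \<zeta> 0 0 = 0"
    "eventually (\<lambda>(q,X,Y). deformed_sum d q 0 0 - deformed_sum d q X 0 - deformed_sum d q 0 Y + deformed_sum d q X Y
       = X * Y * H q X Y) (nhds (\<zeta>,0::complex,0::complex))"
proof -
  have "\<exists>g. k < d \<longrightarrow> isCont (\<lambda>(q,X). g q X) (\<zeta>, 0) \<and>
    eventually (\<lambda>(q,X). facA k q X = facA k q 0 + X * g q X) (nhds (\<zeta>, 0))" for k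
  proof (cases "k < d")
    case True
    then have "\<zeta> ^ (4*j+4) \<noteq> 1" if "j < k" for j using that by (intro denominators_ne_1) auto
    then obtain g where "isCont (\<lambda>(q,X). g q X) (\<zeta>, 0)"
      "eventually (\<lambda>(q,X). facA k q X = facA k q 0 + X * g q X) (nhds (\<zeta>, 0))"
      by (rule quad_ratio_difference)
    then show ?thesis by (intro exI[of _ g] impI conjI)
  qed auto
  then have "\<exists>g. \<forall>k. k < d \<longrightarrow> isCont (\<lambda>(q,X). g k q X) (\<zeta>, 0) \<and>
    eventually (\<lambda>(q,X). facA k q X = facA k q 0 + X * g k q X) (nhds (\<zeta>, 0))"
    by (intro choice allI)
  then obtain ga where ga: "k < d \<Longrightarrow> isCont (\<lambda>(q,X). ga k q X) (\<zeta>, 0)"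
    "k < d \<Longrightarrow> eventually (\<lambda>(q,X). facA k q X = facA k q 0 + X * ga k q X) (nhds (\<zeta>, 0))" for k
    by blast
  have "\<exists>g. k < d \<longrightarrow> isCont (\<lambda>(q,X). g q X) (\<zeta>, 0) \<and>
    eventually (\<lambda>(q,X). facB k q X = facB k q 0 + X * g q X) (nhds (\<zeta>, 0))" for k
  proof (cases "k < d")
    case True
    then have "\<zeta> ^ (2*j+2) \<noteq> 1" if "j < k" for j using that by (intro denominators_ne_1) auto
    then obtain g where "isCont (\<lambda>(q,X). g q X) (\<zeta>, 0)"
      "eventually (\<lambda>(q,X). facB k q X = facB k q 0 + X * g q X) (nhds (\<zeta>, 0))"
      by (rule quad_ratio_difference)
    then show ?thesis by (intro exI[of _ g] impI conjI)
  qed auto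
  then have "\<exists>g. \<forall>k. k < d \<longrightarrow> isCont (\<lambda>(q,X). g k q X) (\<zeta>, 0) \<and>
    eventually (\<lambda>(q,X). facB k q X = facB k q 0 + X * g k q X) (nhds (\<zeta>, 0))"
    by (intro choice allI)
  then obtain gb where gb: "k < d \<Longrightarrow> isCont (\<lambda>(q,X). gb k q X) (\<zeta>, 0)"
    "k < d \<Longrightarrow> eventually (\<lambda>(q,X). facB k q X = facB k q 0 + X * gb k q X) (nhds (\<zeta>, 0))" for k
    by blast
  define H where "H q X Y = (\<Sum>k<d. coef k q * ga k q X * gb k q Y)" for q X Y
  have c: "isCont (\<lambda>p. H (fst p) (fst (snd p)) (snd (snd p))) (\<zeta>,0,0)"
    unfolding H_def
  proof (intro continuous_intros)
    fix k assume "k \<in> {..<d}"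
    then have k: "k < d" by simp
    have "isCont (coef k) \<zeta>"
      using k denominators_ne_1 root_ne_1 by (intro isCont_coef) auto
    then have "((\<lambda>p. coef k (fst p)) \<longlongrightarrow> coef k \<zeta>) (at (\<zeta>,0::complex,0::complex))"
      by (rule isCont_tendsto_compose) (auto intro!: tendsto_eq_intros)
    then show "isCont (\<lambda>p. coef k (fst p)) (\<zeta>,0::complex,0::complex)"
      by (simp add: isCont_def)
    have "((\<lambda>p. (case (fst p, fst (snd p)) of (q, X) \<Rightarrow> ga k q X)) \<longlongrightarrow> (case (\<zeta>,0) of (q, X) \<Rightarrow> ga k q X)) (at (\<zeta>,0,0::complex))"
      by (rule isCont_tendsto_compose[where f = "\<lambda>p. (fst p, fst (snd p))", OF ga(1)[OF k]]) (auto intro!: tendsto_eq_intros)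
    then show "isCont (\<lambda>p. ga k (fst p) (fst (snd p))) (\<zeta>,0,0::complex)"
      by (simp add: isCont_def)
    have "((\<lambda>p. (case (fst p, snd (snd p)) of (q, X) \<Rightarrow> gb k q X)) \<longlongrightarrow> (case (\<zeta>,0) of (q, X) \<Rightarrow> gb k q X)) (at (\<zeta>,0::complex,0))"
      by (rule isCont_tendsto_compose[where f = "\<lambda>p. (fst p, snd (snd p))", OF gb(1)[OF k]]) (auto intro!: tendsto_eq_intros)
    then show "isCont (\<lambda>p. gb k (fst p) (snd (snd p))) (\<zeta>,0::complex,0)"
      by (simp add: isCont_def)
  qed
  have ev: "eventually (\<lambda>p. deformed_sum d (fst p) 0 0 - deformed_sum d (fst p) (fst (snd p)) 0
       - deformed_sum d (fst p) 0 (snd (snd p)) + deformed_sum d (fst p) (fst (snd p)) (snd (snd p))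
       = fst (snd p) * snd (snd p) * H (fst p) (fst (snd p)) (snd (snd p))) (nhds (\<zeta>,0::complex,0::complex))"
  proof -
    have "filterlim (\<lambda>p. (fst p, fst (snd p))) (nhds (\<zeta>,0)) (nhds (\<zeta>,0,0::complex))"
      "filterlim (\<lambda>p. (fst p, snd (snd p))) (nhds (\<zeta>,0)) (nhds (\<zeta>,0::complex,0))"
      by (auto intro!: tendsto_eq_intros filterlim_ident)
    note fl = this
    have "eventually (\<lambda>p. \<forall>k\<in>{..<d}. facA k (fst p) (fst (snd p)) = facA k (fst p) 0 + fst (snd p) * ga k (fst p) (fst (snd p))
      \<and> facB k (fst p) (snd (snd p)) = facB k (fst p) 0 + snd (snd p) * gb k (fst p) (snd (snd p))) (nhds (\<zeta>,0::complex,0::complex))"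
    proof (intro eventually_ball_finite ballI eventually_conj)
      fix k assume "k \<in> {..<d}"
      then have k: "k < d" by simp
      show "eventually (\<lambda>p. facA k (fst p) (fst (snd p)) = facA k (fst p) 0 + fst (snd p) * ga k (fst p) (fst (snd p))) (nhds (\<zeta>,0::complex,0::complex))"
        using eventually_compose_filterlim[OF ga(2)[OF k] fl(1)] by simp
      show "eventually (\<lambda>p. facB k (fst p) (snd (snd p)) = facB k (fst p) 0 + snd (snd p) * gb k (fst p) (snd (snd p))) (nhds (\<zeta>,0::complex,0::complex))"
        using eventually_compose_filterlim[OF gb(2)[OF k] fl(2)] by simp
    qed simp
    then show ?thesis
    proof eventually_elim
      case (elim p)
      obtain q X Y where p: "p = (q,X,Y)" by (cases p) auto
      show ?case
        unfolding p fst_conv snd_conv deformed_sum_def H_def sum_distrib_left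
          sum_subtractf[symmetric] sum.distrib[symmetric]
      proof (intro sum.cong refl)
        fix k assume k: "k \<in> {..<d}"
        have *: "facA k q X = facA k q 0 + X * ga k q X" "facB k q Y = facB k q 0 + Y * gb k q Y"
          using elim k unfolding p by auto
        show "coef k q * facA k q 0 * facB k q 0 - coef k q * facA k q X * facB k q 0 -
         coef k q * facA k q 0 * facB k q Y + coef k q * facA k q X * facB k q Y =
         X * Y * (coef k q * ga k q X * gb k q Y)"
          unfolding * by (simp add: algebra_simps)
      qed
    qed
  qed
  \<comment> \<open>Along \<open>X = Y = small t\<close> at \<open>q = \<zeta>\<close> all four sums
    vanish, so \<open>(small t)^2 * H = 0\<close> with \<open>small t \<noteq> 0\<close>; continuity
    carries this to the origin.\<close>
  have "H \<zeta> 0 0 = 0"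
  proof -
    have fl: "filterlim (\<lambda>t. (\<zeta>, small t, small t)) (nhds (\<zeta>,0::complex,0::complex)) (at_right 0)"
      by (intro tendsto_intros tendsto_small)
    have "((\<lambda>t. H \<zeta> (small t) (small t)) \<longlongrightarrow> H \<zeta> 0 0) (at_right 0)"
      using isCont_tendsto_compose[OF c fl] by simp
    moreover have "eventually (\<lambda>t. H \<zeta> (small t) (small t) = 0) (at_right 0)"
      using eventually_compose_filterlim[OF ev fl] deformed_sum_small eventually_small
      by eventually_elim (auto simp: deformed_sum_0)
    ultimately have "((\<lambda>t::real. 0) \<longlongrightarrow> H \<zeta> 0 0) (at_right 0)"
      by (rule Lim_transform_eventually)
    then show ?thesis
      using tendsto_unique[OF trivial_limit_at_right_real _ tendsto_const] by blast
  qed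
  show ?thesis
  proof (rule that)
    show "isCont (\<lambda>(q,X,Y). H q X Y) (\<zeta>,0,0)"
      using c by (simp only: case_prod_unfold)
    show "H \<zeta> 0 0 = 0" by fact
    show "eventually (\<lambda>(q,X,Y). deformed_sum d q 0 0 - deformed_sum d q X 0 - deformed_sum d q 0 Y + deformed_sum d q X Y
       = X * Y * H q X Y) (nhds (\<zeta>,0,0))"
      using ev by (simp only: case_prod_unfold)
  qed
qed

end

subsection \<open>The order five estimate\<close>

definition rhs :: "nat \<Rightarrow> complex \<Rightarrow> complex"
  where "rhs n q = qint q (3*n) * (q^(2*n) * (2 - q^n) / (1 + q^n)^2) * facW ((3*n-1) div 4) q 0"

text \<open>The source of the factor \<open>t^2 * (2 - t) / (1 + t)^2\<close>, with
  \<open>t = q^d\<close>. The closed forms at \<open>0\<close> and at \<open>X\<close> share a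
  factor, equal to \<open>(1-t)^2 * (1+t)^2\<close> and \<open>(1-t)^2 * (1+t+t^2)\<close>
  respectively, and \<open>(1+t)^2 - (1+t+t^2)\<close> differs from \<open>t^2 * (2-t)\<close> by
  \<open>t * (1-t)^2\<close> only. Everything else carries \<open>X * Y\<close> or
  \<open>(1-t)^2 * X\<close>, so \<open>(1-t)^4\<close> comes out in front.\<close>

lemma deformed_difference_identity:
  fixes t X Y V V' g h K S :: complex
  assumes t: "t \<noteq> 0" "1 + t \<noteq> 0" and X: "X = 2 - t - 1/t" and Y: "Y = 2 - t^3 - 1/t^3"
    and V': "V' = V + X * g"
    and S: "S = X * Y * h + K * (quad (t^2) 0 * V - quad (t^2) X * V')"
  shows "S - K * (t^2 * (2 - t) / (1 + t)^2) * (quad (t^2) 0 * V)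
    = (1 - t)^4 * ((1 + t + t^2)^2 / t^4 * h + K * (V * t + g * (1 + t + t^2) / t))"
proof -
  have *: "2 - s - 1/s = - ((1 - s)^2 / s)" if "s \<noteq> 0" for s :: complex
    using that by (simp add: field_simps power2_eq_square)
  have X': "X = - ((1 - t)^2 / t)"
    unfolding X by (rule *[OF t(1)])
  have "(1 - t^3)^2 = (1 - t)^2 * (1 + t + t^2)^2" by algebra
  then have Y': "Y = - ((1 - t)^2 * (1 + t + t^2)^2 / t^3)"
    unfolding Y using *[of "t^3"] t(1) by simp
  have Q0: "quad (t^2) 0 = (1 - t)^2 * (1 + t)^2"
    unfolding quad_def by algebra
  have "t^2 * (2 - t - 1/t) = 2 * t^2 - t^3 - t"
    using t(1) by (simp add: field_simps eval_nat_numeral)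
  then have QX: "quad (t^2) X = (1 - t)^2 * (1 + t + t^2)"
    unfolding X quad_def by algebra
  have "K * (t^2 * (2 - t) / (1 + t)^2) * (quad (t^2) 0 * V) = K * (t^2 * (2 - t)) * (1 - t)^2 * V"
    unfolding Q0 using t(2) by (simp add: field_simps)
  then have "S - K * (t^2 * (2 - t) / (1 + t)^2) * (quad (t^2) 0 * V)
    = X * Y * h + K * (1 - t)^2 * (((1 + t)^2 - t^2 * (2 - t) - (1 + t + t^2)) * V - (1 + t + t^2) * (X * g))"
    unfolding S V' Q0 QX by (simp add: algebra_simps)
  also have "(1 + t)^2 - t^2 * (2 - t) - (1 + t + t^2) = (1 - t)^2 * t"
    by algebra
  also have "X * Y = (1 - t)^4 * ((1 + t + t^2)^2 / t^4)"
    unfolding X' Y' using t(1) by (simp add: divide_simps) algebra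
  also have "(1 + t + t^2) * (X * g) = - ((1 - t)^2) * (g * (1 + t + t^2) / t)"
    unfolding X' by simp
  also have "(1 - t)^4 * A * h + K * (1 - t)^2 * ((1 - t)^2 * t * V - - ((1 - t)^2) * B)
    = (1 - t)^4 * (A * h + K * (V * t + B))" for A B
    by algebra
  finally show ?thesis .
qed

context odd_root begin

lemma main_estimate:
  assumes d: "d = 4*m+3"
  shows "((\<lambda>q. (deformed_sum d q 0 0 - rhs d q) / (q - \<zeta>)^4) \<longlongrightarrow> 0) (disc_at \<zeta>)"
proof -
  \<comment> \<open>Chosen so that \<open>4*N+1 = 3*d\<close>; the inequality
    \<open>2*m+1 < N\<close> places the factor with exponent \<open>4*(2*m+1)+2 = 2*d\<close> in the
    product.\<close>
  define N where "N = 3*m+2"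
  have N: "(3*d-1) div 4 = N" "4*N+1 = 3*d" "N < d" "2*m+1 < N" by (simp_all add: N_def d)
  obtain p where p: "continuous_on UNIV p" "\<And>q. 1 - q^d = (q - \<zeta>) * p q"
    using one_minus_power_factor[of \<zeta> d] root by (metis dvd_refl)
  obtain H where H: "isCont (\<lambda>(q,X,Y). H q X Y) (\<zeta>,0,0)" "H \<zeta> 0 0 = 0"
    and evH: "eventually (\<lambda>(q,X,Y). deformed_sum d q 0 0 - deformed_sum d q X 0 - deformed_sum d q 0 Y + deformed_sum d q X Y
       = X * Y * H q X Y) (nhds (\<zeta>,0,0))"
    by (rule double_difference)
  \<comment> \<open>The closed form without the factor at \<open>2*m+1\<close>, the one that
    vanishes at \<open>\<zeta>\<close> when \<open>X = 0\<close>.\<close>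
  define V where "V q X = (\<Prod>j\<in>{..<N}-{2*m+1}. quad (q^(4*j+2)) X) / (\<Prod>j\<in>{..<N}. quad (q^(4*j+4)) X)" for q X
  have den: "\<zeta> ^ (4*j+4) \<noteq> 1" if "j \<in> {..<N}" for j
    using that N by (intro denominators_ne_1) auto
  obtain g where g: "isCont (\<lambda>(q,X). g q X) (\<zeta>,0)"
    and evg: "eventually (\<lambda>(q,X). V q X = V q 0 + X * g q X) (nhds (\<zeta>,0))"
  proof (rule quad_quotient_difference[where A = "{..<N}-{2*m+1}" and B = "{..<N}" and \<zeta> = \<zeta> and e = "\<lambda>j. 4*j+2" and e' = "\<lambda>j. 4*j+4"])
    show "finite ({..<N}-{2*m+1})" "finite {..<N}" by auto
    show "\<zeta> ^ (4*j+4) \<noteq> 1" if "j \<in> {..<N}" for j using that by (rule den)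
  qed (rule that[unfolded V_def])
  have W: "facW N q X = quad ((q^d)^2) X * V q X" for q X
  proof -
    have "4*(2*m+1)+2 = d*2" by (simp add: d)
    then have "(\<Prod>j<N. quad (q^(4*j+2)) X) = quad ((q^d)^2) X * (\<Prod>j\<in>{..<N}-{2*m+1}. quad (q^(4*j+2)) X)"
      using N by (subst prod.remove[of _ "2*m+1"]) (auto simp only: power_mult lessThan_iff finite_lessThan)
    then show ?thesis by (simp add: quad_ratio_def V_def prod_dividef)
  qed
  define X where "X q = 2 - q^d - 1/q^d" for q :: complex
  define Y where "Y q = 2 - q^(3*d) - 1/q^(3*d)" for q :: complex
  have id: "((\<lambda>q. q) \<longlongrightarrow> \<zeta>) (disc_at \<zeta>)" by (rule tendsto_ident_at)
  have \<zeta>d: "\<zeta>^d = 1" "\<zeta>^(3*d) = 1" using root by auto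
  have limX: "(X \<longlongrightarrow> 0) (disc_at \<zeta>)"
    unfolding X_def using \<zeta>d by (auto intro!: tendsto_eq_intros id)
  have limY: "(Y \<longlongrightarrow> 0) (disc_at \<zeta>)"
    unfolding Y_def using \<zeta>d by (auto intro!: tendsto_eq_intros id)
  have fl: "filterlim (\<lambda>q. (q, X q, Y q)) (nhds (\<zeta>,0,0)) (disc_at \<zeta>)" "filterlim (\<lambda>q. (q, X q)) (nhds (\<zeta>,0)) (disc_at \<zeta>)"
    by (intro tendsto_intros id limX limY)+
  define R where "R q = p q^4 * ((1 + q^d + (q^d)^2)^2 / (q^d)^4 * H q (X q) (Y q)
    + qint q (3*d) * (V q 0 * q^d + g q (X q) * (1 + q^d + (q^d)^2) / q^d))" for q
  have "eventually (\<lambda>q. q \<noteq> \<zeta>) (disc_at \<zeta>)" by (simp add: eventually_at_filter)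
  then have "eventually (\<lambda>q. R q = (deformed_sum d q 0 0 - rhs d q) / (q - \<zeta>)^4) (disc_at \<zeta>)"
    using eventually_disc_at eventually_compose_filterlim[OF evH fl(1)] eventually_compose_filterlim[OF evg fl(2)]
  proof eventually_elim
    case (elim q)
    then have q: "q \<noteq> 0" "norm q < 1" by auto
    note inj = power_inj_of_norm_less_1[OF q] and ne1 = power_ne_1_of_norm_less_1[OF q]
    have t: "q^d \<noteq> 0" "1 + q^d \<noteq> 0"
    proof -
      show "q^d \<noteq> 0" using q by simp
      have "norm (q^d) < 1" using q d_gt_1 by (simp add: norm_power power_less_one_iff)
      then show "1 + q^d \<noteq> 0" by (metis add_eq_0_iff norm_minus_cancel norm_one less_irrefl)
    qed
    have "odd d" by (simp add: d)
    have "deformed_sum d q (X q) 0 = 0"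
      unfolding X_def by (rule deformed_sum_at_X[OF q d])
    moreover have "deformed_sum d q 0 (Y q) = qint q (3*d) * facW N q 0"
    proof -
      have "q^(4*j+4) \<noteq> 1" "q^(4*j+4) * 1 \<noteq> 1" for j using ne1[of "4*j+4"] by auto
      then show ?thesis
        using deformed_sum_at_Y[OF q one_neq_zero _ _ \<open>N < d\<close>] unfolding Y_def N(2) by simp
    qed
    moreover have "deformed_sum d q (X q) (Y q) = qint q (3*d) * facW N q (X q)"
    proof -
      have "q^(4*j+4) \<noteq> q^d" "q^(4*j+4) * q^d \<noteq> 1" for j
      proof -
        \<comment> \<open>Parity keeps \<open>x = q^d\<close> away from the poles of the closed
          form.\<close>
        have "4*j+4 \<noteq> d" using \<open>odd d\<close> by auto
        then show "q^(4*j+4) \<noteq> q^d" unfolding inj .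
        show "q^(4*j+4) * q^d \<noteq> 1" unfolding power_add[symmetric] by (rule ne1) simp
      qed
      then show ?thesis
        using deformed_sum_at_Y[OF q t(1) _ _ \<open>N < d\<close>] unfolding Y_def X_def N(2) by blast
    qed
    ultimately have S: "deformed_sum d q 0 0 = X q * Y q * H q (X q) (Y q)
      + qint q (3*d) * (quad ((q^d)^2) 0 * V q 0 - quad ((q^d)^2) (X q) * V q (X q))"
      using elim(3) unfolding W by (simp add: algebra_simps)
    have "deformed_sum d q 0 0 - qint q (3*d) * ((q^d)^2 * (2 - q^d) / (1 + q^d)^2) * (quad ((q^d)^2) 0 * V q 0)
      = (1 - q^d)^4 * ((1 + q^d + (q^d)^2)^2 / (q^d)^4 * H q (X q) (Y q)
        + qint q (3*d) * (V q 0 * q^d + g q (X q) * (1 + q^d + (q^d)^2) / q^d))"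
    proof (rule deformed_difference_identity[OF t _ _ _ S])
      show "X q = 2 - q^d - 1/q^d" by (simp add: X_def)
      show "Y q = 2 - (q^d)^3 - 1/(q^d)^3"
        by (simp only: Y_def power_mult[symmetric] mult.commute)
      show "V q (X q) = V q 0 + X q * g q (X q)" using elim(4) by simp
    qed
    then have "deformed_sum d q 0 0 - rhs d q = (q - \<zeta>)^4 * R q"
      unfolding rhs_def N(1) W p(2) power_mult_distrib R_def
      by (simp only: power_mult[symmetric] mult.commute[of 2 d] mult.assoc)
    then show ?case using elim(1) by simp
  qed
  moreover have "(R \<longlongrightarrow> 0) (disc_at \<zeta>)"
  proof -
    have "(p \<longlongrightarrow> p \<zeta>) (disc_at \<zeta>)"
      using p(1) continuous_on_eq_continuous_at[OF open_UNIV] continuous_at_imp_continuous_within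
      unfolding continuous_within by blast
    moreover have "((\<lambda>q. H q (X q) (Y q)) \<longlongrightarrow> 0) (disc_at \<zeta>)"
      using isCont_tendsto_compose[OF H(1) fl(1)] H(2) by simp
    moreover have "((\<lambda>q. g q (X q)) \<longlongrightarrow> g \<zeta> 0) (disc_at \<zeta>)"
      using isCont_tendsto_compose[OF g fl(2)] by simp
    moreover have "((\<lambda>q. V q 0) \<longlongrightarrow> V \<zeta> 0) (disc_at \<zeta>)"
      unfolding V_def quad_0 by (intro tendsto_intros id) (use den in simp)
    moreover have "((\<lambda>q. qint q (3*d)) \<longlongrightarrow> 0) (disc_at \<zeta>)"
      unfolding qint_def using \<zeta>d root_ne_1 by (auto intro!: tendsto_eq_intros id)
    moreover have "((\<lambda>q. q^d) \<longlongrightarrow> 1) (disc_at \<zeta>)"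
      using tendsto_power[OF id, of d] \<zeta>d by simp
    \<comment> \<open>Four orders are accounted for by \<open>(1 - q^d)^4\<close>. The fifth comes
      from the two zeros inside: the limit of \<open>H\<close> and that of
      \<open>qint q (3*d)\<close>.\<close>
    ultimately have "(R \<longlongrightarrow> p \<zeta>^4 * ((1 + 1 + 1^2)^2 / 1^4 * 0 + 0 * (V \<zeta> 0 * 1 + g \<zeta> 0 * (1 + 1 + 1^2) / 1))) (disc_at \<zeta>)"
      unfolding R_def by (intro tendsto_intros) auto
    then show ?thesis by simp
  qed
  ultimately show ?thesis by (rule Lim_transform_eventually[rotated])
qed

end

subsection \<open>Boundedness, and roots of unity of smaller order\<close>

text \<open>Cut the indices into blocks of length \<open>d\<close>. The condition with
  \<open>r*j+r\<close> holds exactly at the last place of each block, the one with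
  \<open>r*j+s\<close> at a fixed place \<open>i\<close>. A block that reaches its last place has
  already passed place \<open>i\<close>.\<close>

lemma card_zero_factors_le:
  fixes d r s k :: nat
  assumes "coprime r d" "d > 0"
  shows "card {j\<in>{..<k}. d dvd r*j+r} \<le> card {j\<in>{..<k}. d dvd r*j+s}"
proof -
  obtain x where x: "[r * x = 1] (mod d)"
    using cong_solve_coprime_nat[OF assms(1)] by auto
  \<comment> \<open>The solution of \<open>r*i + s \<equiv> 0\<close> modulo \<open>d\<close>, with
    \<open>(d - 1) * s\<close> standing for \<open>-s\<close>.\<close>
  define i where "i = (x * ((d - 1) * s)) mod d"
  have "i < d" using assms(2) by (simp add: i_def)
  have i: "d dvd r*i+s"
  proof -
    have "[r*i+s = (r*x)*((d-1)* s)+s] (mod d)"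
      unfolding i_def mult.assoc by (intro cong_add cong_mult cong_refl) (simp add: cong_def)
    also have "[(r*x)*((d-1)* s)+s = 1*((d-1)* s)+s] (mod d)"
      by (intro cong_add cong_mult x cong_refl)
    also have "1*((d-1)* s)+s = d* s"
      using assms(2) by (cases d) auto
    finally show ?thesis by (simp add: cong_dvd_iff)
  qed
  have D: "d dvd r*j+r \<longleftrightarrow> d dvd j+1" for j
  proof -
    have "r*j+r = r*(j+1)" by simp
    then show ?thesis
      using coprime_dvd_mult_right_iff[of d r "j+1"] assms(1) by (simp only: coprime_commute)
  qed
  have le: "d \<le> j+1" if "d dvd j+1" for j
    using that by (rule dvd_imp_le) simp
  show ?thesis
  proof (rule card_inj_on_le)
    \<comment> \<open>The map sends the last place of a block to place \<open>i\<close> of the same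
      block.\<close>
    show "inj_on (\<lambda>j. j+1-d+i) {j\<in>{..<k}. d dvd r*j+r}"
    proof (rule inj_onI, unfold D)
      fix x y assume *: "x \<in> {j\<in>{..<k}. d dvd j+1}" "y \<in> {j\<in>{..<k}. d dvd j+1}" "x+1-d+i = y+1-d+i"
      then have "d dvd x+1" "d dvd y+1" by blast+
      then have "d \<le> x+1" "d \<le> y+1" by (simp_all only: le)
      with *(3) show "x = y" by linarith
    qed
    show "(\<lambda>j. j+1-d+i) ` {j\<in>{..<k}. d dvd r*j+r} \<subseteq> {j\<in>{..<k}. d dvd r*j+s}"
    proof (rule image_subsetI)
      fix j assume "j \<in> {j\<in>{..<k}. d dvd r*j+r}"
      then have j: "j < k" "d dvd j+1" by (simp_all only: D mem_Collect_eq lessThan_iff)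
      have "d \<le> j+1" by (rule le) fact
      have "d dvd j+1-d" using \<open>d dvd j+1\<close> by (simp add: dvd_diff_nat)
      then have "d dvd r*(j+1-d)+(r*i+s)" by (intro dvd_add dvd_mult i)
      then have "d dvd r*(j+1-d+i)+s" by (simp only: distrib_left add.assoc)
      moreover have "j+1-d+i < k" using j(1) \<open>i < d\<close> \<open>d \<le> j+1\<close> by simp
      ultimately show "j+1-d+i \<in> {j\<in>{..<k}. d dvd r*j+s}" by blast
    qed
  qed simp
qed

definition qratio :: "nat \<Rightarrow> nat \<Rightarrow> nat \<Rightarrow> complex \<Rightarrow> complex"
  where "qratio r s k q = (\<Prod>j<k. (1 - q^(r*j+s)) / (1 - q^(r*j+r)))"

text \<open>Without deformation the factors can be regrouped so that numerator and denominator have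
  the same base, as the count of zero factors requires.\<close>

lemma facA_0: "facA k q 0 * facB k q 0 = qratio 4 1 k q ^ 2 * qratio 2 1 k q ^ 2"
  by (simp add: quad_ratio_def qratio_def prod_dividef power_divide flip: prod_power_distrib)

lemma facW_0: "facW k q 0 = qratio 4 2 k q ^ 2"
  by (simp add: quad_ratio_def qratio_def prod_dividef power_divide flip: prod_power_distrib)

context odd_root begin

lemma one_minus_power_order:
  assumes "a > 0"
  obtains p where "continuous_on UNIV p" "p \<zeta> \<noteq> 0"
    "\<And>q. 1 - q ^ a = (q - \<zeta>) ^ (if d dvd a then 1 else 0) * p q"
proof (cases "d dvd a")
  case True
  then obtain p where "continuous_on UNIV p" "\<And>q. 1 - q ^ a = (q - \<zeta>) * p q" "a > 0 \<Longrightarrow> p \<zeta> \<noteq> 0"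
    using one_minus_power_factor[of \<zeta> a] root by metis
  then show ?thesis using that[of p] True assms by simp
next
  case False
  then have "\<zeta> ^ a \<noteq> 1" by (simp add: root)
  moreover have "continuous_on UNIV (\<lambda>q::complex. 1 - q ^ a)" by (intro continuous_intros)
  ultimately show ?thesis using that[of "\<lambda>q. 1 - q ^ a"] False by simp
qed

lemma prod_one_minus_power:
  fixes a :: "nat \<Rightarrow> nat"
  shows "(\<And>j. j < k \<Longrightarrow> a j > 0) \<Longrightarrow> \<exists>p. (p \<longlongrightarrow> p \<zeta>) (disc_at \<zeta>) \<and> p \<zeta> \<noteq> 0 \<and>
    (\<forall>q. (\<Prod>j<k. 1 - q ^ a j) = (q - \<zeta>) ^ card {j\<in>{..<k}. d dvd a j} * p q)"
proof (induction k)
  case 0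
  show ?case by (intro exI[of _ "\<lambda>_. 1"]) simp
next
  case (Suc k)
  then obtain p where p: "(p \<longlongrightarrow> p \<zeta>) (disc_at \<zeta>)" "p \<zeta> \<noteq> 0"
    "\<And>q. (\<Prod>j<k. 1 - q ^ a j) = (q - \<zeta>) ^ card {j\<in>{..<k}. d dvd a j} * p q"
    by auto
  obtain r where r: "continuous_on UNIV r" "r \<zeta> \<noteq> 0"
    "\<And>q. 1 - q ^ a k = (q - \<zeta>) ^ (if d dvd a k then 1 else 0) * r q"
    using Suc(2)[of k] by (auto intro: one_minus_power_order)
  have "(r \<longlongrightarrow> r \<zeta>) (disc_at \<zeta>)"
  proof -
    have "isCont r \<zeta>" using r(1) by (simp add: continuous_on_eq_continuous_at)
    then show ?thesis unfolding isCont_def by (rule tendsto_within_subset) simp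
  qed
  then have "((\<lambda>q. p q * r q) \<longlongrightarrow> p \<zeta> * r \<zeta>) (disc_at \<zeta>)"
    by (intro tendsto_mult p)
  moreover have "{j\<in>{..<Suc k}. d dvd a j} = (if d dvd a k then insert k {j\<in>{..<k}. d dvd a j} else {j\<in>{..<k}. d dvd a j})"
    by (auto simp: less_Suc_eq)
  then have "card {j\<in>{..<Suc k}. d dvd a j} = card {j\<in>{..<k}. d dvd a j} + (if d dvd a k then 1 else 0)"
    by simp
  then have "(\<Prod>j<Suc k. 1 - q ^ a j) = (q - \<zeta>) ^ card {j\<in>{..<Suc k}. d dvd a j} * (p q * r q)" for q
    by (simp only: prod.lessThan_Suc p(3) r(3) power_add mult_ac)
  ultimately show ?case using p(2) r(2) by (intro exI[of _ "\<lambda>q. p q * r q"]) simp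
qed

text \<open>The order of vanishing of each product at \<open>\<zeta>\<close> is the number of its
  zero factors, and the numerator has at least as many as the denominator.\<close>

lemma qratio_bounded:
  assumes "coprime r d" "r > 0" "s > 0"
  shows "qratio r s k \<in> O[disc_at \<zeta>](\<lambda>_. 1)"
proof -
  obtain p where p: "(p \<longlongrightarrow> p \<zeta>) (disc_at \<zeta>)" "p \<zeta> \<noteq> 0"
    "\<And>q. (\<Prod>j<k. 1 - q ^ (r*j+s)) = (q - \<zeta>) ^ card {j\<in>{..<k}. d dvd r*j+s} * p q"
    using prod_one_minus_power[of k "\<lambda>j. r*j+s"] assms by auto
  obtain p' where p': "(p' \<longlongrightarrow> p' \<zeta>) (disc_at \<zeta>)" "p' \<zeta> \<noteq> 0"
    "\<And>q. (\<Prod>j<k. 1 - q ^ (r*j+r)) = (q - \<zeta>) ^ card {j\<in>{..<k}. d dvd r*j+r} * p' q"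
    using prod_one_minus_power[of k "\<lambda>j. r*j+r"] assms by auto
  define m where "m = card {j\<in>{..<k}. d dvd r*j+r}"
  define m' where "m' = card {j\<in>{..<k}. d dvd r*j+s} - m"
  have m: "card {j\<in>{..<k}. d dvd r*j+s} = m + m'"
    using card_zero_factors_le[OF assms(1), of k s] d_gt_1 by (simp add: m_def m'_def)
  have lim: "((\<lambda>q. (q - \<zeta>) ^ m' * p q / p' q) \<longlongrightarrow> (\<zeta> - \<zeta>) ^ m' * p \<zeta> / p' \<zeta>) (disc_at \<zeta>)"
    by (intro tendsto_intros p p')
  have "eventually (\<lambda>q. q \<noteq> \<zeta>) (disc_at \<zeta>)" by (simp add: eventually_at_filter)
  then have "eventually (\<lambda>q. (q - \<zeta>) ^ m' * p q / p' q = qratio r s k q) (disc_at \<zeta>)"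
  proof eventually_elim
    case (elim q)
    have "qratio r s k q = (q - \<zeta>) ^ (m + m') * p q / ((q - \<zeta>) ^ m * p' q)"
      by (simp only: qratio_def prod_dividef p(3) p'(3) m m_def[symmetric])
    then show ?case using elim by (simp add: power_add)
  qed
  with lim have "(qratio r s k \<longlongrightarrow> (\<zeta> - \<zeta>) ^ m' * p \<zeta> / p' \<zeta>) (disc_at \<zeta>)"
    by (rule Lim_transform_eventually)
  then show ?thesis by (intro bigoI_tendsto) auto
qed

lemma coprime_2_4: "coprime 2 d" "coprime 4 d"
proof -
  show "coprime 2 d" using odd_d by simp
  then have "coprime (2^2) d" by (simp only: coprime_power_left_iff simp_thms)
  then show "coprime 4 d" by simp
qed

lemma id_tendsto: "((\<lambda>q. q) \<longlongrightarrow> \<zeta>) (disc_at \<zeta>)"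
  by (rule tendsto_ident_at)

lemma qint_tendsto: "((\<lambda>q. qint q r) \<longlongrightarrow> qint \<zeta> r) (disc_at \<zeta>)"
  unfolding qint_def using root_ne_1 by (intro tendsto_intros id_tendsto) auto

text \<open>Quotient of successive terms apart from \<open>qint\<close> and the power of
  \<open>q\<close>. Its exponents are linear in \<open>j\<close>, hence its value at
  \<open>\<zeta>\<close> has period \<open>d\<close> in \<open>j\<close>.\<close>

definition pfac :: "nat \<Rightarrow> complex \<Rightarrow> complex"
  where "pfac j q = (1 - q^(4*j+2)) / (1 - q^(4*j+4)) * ((1 - q^(2*j+1))^2 / (1 - q^(4*j+4))^2) *
    ((1 - q^(4*j+1))^2 / (1 - q^(2*j+2))^2)"

lemma term_eq: "coef k q * facA k q 0 * facB k q 0 = qint q (6*k+1) * q^(2*k) * (\<Prod>j<k. pfac j q)"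
  by (simp only: coef_def quad_ratio_def pfac_def prod.distrib quad_0 mult.assoc)

lemma prod_pfac_bounded: "(\<lambda>q. \<Prod>j<k. pfac j q) \<in> O[disc_at \<zeta>](\<lambda>_. 1)"
proof -
  have "(\<lambda>q. \<Prod>j<k. pfac j q) = (\<lambda>q. qratio 4 2 k q * (qratio 4 1 k q ^ 2 * qratio 2 1 k q ^ 2))"
  proof
    fix q
    show "(\<Prod>j<k. pfac j q) = qratio 4 2 k q * (qratio 4 1 k q ^ 2 * qratio 2 1 k q ^ 2)"
      unfolding facA_0[symmetric]
      by (simp only: quad_ratio_def pfac_def qratio_def prod.distrib quad_0 mult.assoc)
  qed
  moreover have "(\<lambda>q. qratio 4 2 k q * (qratio 4 1 k q ^ 2 * qratio 2 1 k q ^ 2)) \<in> O[disc_at \<zeta>](\<lambda>_. 1 * (1 ^ 2 * 1 ^ 2))"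
    by (intro landau_o.big_mult landau_o.big_power qratio_bounded coprime_2_4) auto
  ultimately show ?thesis by simp
qed

lemma deformed_sum_bounded: "(\<lambda>q. deformed_sum n q 0 0) \<in> O[disc_at \<zeta>](\<lambda>_. 1)"
  unfolding deformed_sum_def term_eq
proof (intro big_sum_in_bigo)
  fix k
  have "(\<lambda>q. qint q (6*k+1) * q^(2*k)) \<in> O[disc_at \<zeta>](\<lambda>_. 1)"
    by (rule bigoI_tendsto[where c = "qint \<zeta> (6*k+1) * \<zeta>^(2*k)"])
       (auto intro!: tendsto_intros qint_tendsto id_tendsto)
  then have "(\<lambda>q. qint q (6*k+1) * q^(2*k) * (\<Prod>j<k. pfac j q)) \<in> O[disc_at \<zeta>](\<lambda>_. 1 * 1)"
    by (intro landau_o.big_mult prod_pfac_bounded)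
  then show "(\<lambda>q. qint q (6*k+1) * q^(2*k) * (\<Prod>j<k. pfac j q)) \<in> O[disc_at \<zeta>](\<lambda>_. 1)"
    by simp
qed

lemma tendsto_0_bounded_mult:
  assumes "f \<in> O[F](\<lambda>_. 1 :: complex)" "(g \<longlongrightarrow> 0) F"
  shows "((\<lambda>q. f q * g q) \<longlongrightarrow> 0) F"
proof -
  have "g \<in> o[F](\<lambda>_. 1)" using assms(2) by (intro smalloI_tendsto) auto
  then have "(\<lambda>q. f q * g q) \<in> o[F](\<lambda>_. 1 * 1)" by (rule landau_o.big_small_mult[OF assms(1)])
  then show ?thesis using smalloD_tendsto[of "\<lambda>q. f q * g q" F "\<lambda>_. 1"] by simp
qed

lemma rhs_tendsto_0:
  assumes "d dvd n"
  shows "(rhs n \<longlongrightarrow> 0) (disc_at \<zeta>)"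
proof -
  have \<zeta>n: "\<zeta>^n = 1" "\<zeta>^(2*n) = 1" "\<zeta>^(3*n) = 1" using assms by (auto simp: root)
  have "((\<lambda>q. qint q (3*n) * (q^(2*n) * (2 - q^n) / (1 + q^n)^2)) \<longlongrightarrow>
    qint \<zeta> (3*n) * (\<zeta>^(2*n) * (2 - \<zeta>^n) / (1 + \<zeta>^n)^2)) (disc_at \<zeta>)"
    by (intro tendsto_intros qint_tendsto id_tendsto) (simp add: \<zeta>n)
  moreover have "qint \<zeta> (3*n) = 0" by (simp add: qint_def \<zeta>n)
  ultimately have "((\<lambda>q. qint q (3*n) * (q^(2*n) * (2 - q^n) / (1 + q^n)^2)) \<longlongrightarrow> 0) (disc_at \<zeta>)"
    by simp
  moreover have "(\<lambda>q. qratio 4 2 ((3*n-1) div 4) q ^ 2) \<in> O[disc_at \<zeta>](\<lambda>_. 1 ^ 2)"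
    by (intro landau_o.big_power qratio_bounded coprime_2_4) auto
  then have "(\<lambda>q. qratio 4 2 ((3*n-1) div 4) q ^ 2) \<in> O[disc_at \<zeta>](\<lambda>_. 1)" by simp
  ultimately have "((\<lambda>q. qratio 4 2 ((3*n-1) div 4) q ^ 2 *
    (qint q (3*n) * (q^(2*n) * (2 - q^n) / (1 + q^n)^2))) \<longlongrightarrow> 0) (disc_at \<zeta>)"
    by (intro tendsto_0_bounded_mult[where f = "\<lambda>q. qratio 4 2 ((3*n-1) div 4) q ^ 2"])
  then show ?thesis unfolding rhs_def facW_0 by (simp add: mult_ac)
qed

lemma root_shift: "\<zeta> ^ (d * l + e) = \<zeta> ^ e"
proof -
  have "\<zeta> ^ (d * l) = 1" by (simp add: root)
  then show ?thesis by (simp add: power_add)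
qed

text \<open>The product in front of a block passes indices at which denominators vanish at
  \<open>\<zeta>\<close>, so it is controlled only by boundedness. Inside a block all factors are
  regular, and by periodicity the block tends to
  \<open>deformed_sum d \<zeta> 0 0 = 0\<close>.\<close>

lemma deformed_sum_tendsto_0:
  assumes "d dvd n"
  shows "((\<lambda>q. deformed_sum n q 0 0) \<longlongrightarrow> 0) (disc_at \<zeta>)"
proof -
  obtain M where n: "n = M * d" using assms by (metis dvd_def mult.commute)
  have prod_split: "(\<Prod>j<l*d+i. pfac j q) = (\<Prod>j<l*d. pfac j q) * (\<Prod>j<i. pfac (l*d+j) q)" for l i q
    by (induction i) (auto simp: mult_ac)
  define I where "I l q = (\<Sum>i<d. qint q (6*(l*d+i)+1) * q^(2*(l*d+i)) * (\<Prod>j<i. pfac (l*d+j) q))" for l q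
  have eq: "deformed_sum n q 0 0 = (\<Sum>l<M. (\<Prod>j<l*d. pfac j q) * I l q)" for q
  proof -
    have "deformed_sum n q 0 0 = (\<Sum>l<M. \<Sum>k=l*d..<l*d+d. qint q (6*k+1) * q^(2*k) * (\<Prod>j<k. pfac j q))"
      unfolding deformed_sum_def term_eq n by (rule sum.nat_group[symmetric])
    also have "\<dots> = (\<Sum>l<M. \<Sum>i<d. qint q (6*(l*d+i)+1) * q^(2*(l*d+i)) * (\<Prod>j<l*d+i. pfac j q))"
    proof (rule sum.cong[OF refl])
      fix l
      show "(\<Sum>k=l*d..<l*d+d. qint q (6*k+1) * q^(2*k) * (\<Prod>j<k. pfac j q))
        = (\<Sum>i<d. qint q (6*(l*d+i)+1) * q^(2*(l*d+i)) * (\<Prod>j<l*d+i. pfac j q))"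
        using sum.shift_bounds_nat_ivl[of "\<lambda>k. qint q (6*k+1) * q^(2*k) * (\<Prod>j<k. pfac j q)" 0 "l*d" d]
        by (simp add: atLeast0LessThan add.commute)
    qed
    finally show ?thesis
      unfolding I_def sum_distrib_left prod_split by (simp add: mult_ac)
  qed
  have "(I l \<longlongrightarrow> 0) (disc_at \<zeta>)" for l
  proof -
    have per: "\<zeta>^(6*(l*d+i)+1) = \<zeta>^(6*i+1)" "\<zeta>^(2*(l*d+i)) = \<zeta>^(2*i)"
      "\<zeta>^(4*(l*d+i)+2) = \<zeta>^(4*i+2)" "\<zeta>^(4*(l*d+i)+4) = \<zeta>^(4*i+4)"
      "\<zeta>^(2*(l*d+i)+1) = \<zeta>^(2*i+1)" "\<zeta>^(4*(l*d+i)+1) = \<zeta>^(4*i+1)"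
      "\<zeta>^(2*(l*d+i)+2) = \<zeta>^(2*i+2)" for i
    proof -
      have "\<zeta>^(x*(l*d+i)+y) = \<zeta>^(x*i+y)" for x y
      proof -
        have "x*(l*d+i)+y = d*(x*l)+(x*i+y)" by (simp add: algebra_simps)
        then show ?thesis by (simp only: root_shift)
      qed
      note * = this
      show "\<zeta>^(6*(l*d+i)+1) = \<zeta>^(6*i+1)" "\<zeta>^(4*(l*d+i)+2) = \<zeta>^(4*i+2)" "\<zeta>^(4*(l*d+i)+4) = \<zeta>^(4*i+4)"
        "\<zeta>^(2*(l*d+i)+1) = \<zeta>^(2*i+1)" "\<zeta>^(4*(l*d+i)+1) = \<zeta>^(4*i+1)" "\<zeta>^(2*(l*d+i)+2) = \<zeta>^(2*i+2)"
        by (rule *)+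
      show "\<zeta>^(2*(l*d+i)) = \<zeta>^(2*i)" using *[of 2 0] by simp
    qed
    have pfac_per: "pfac (l*d+j) \<zeta> = pfac j \<zeta>" for j
      unfolding pfac_def per ..
    \<comment> \<open>The restriction suffices since a block uses \<open>j < i < d\<close>; at
      \<open>j = d - 1\<close> the denominators vanish.\<close>
    have pfac_lim: "(pfac (l*d+j) \<longlongrightarrow> pfac (l*d+j) \<zeta>) (disc_at \<zeta>)" if "j + 1 < d" for j
      unfolding pfac_def using denominators_ne_1[OF that]
      by (intro tendsto_intros id_tendsto) (simp_all only: per, auto)
    have "(I l \<longlongrightarrow> (\<Sum>i<d. qint \<zeta> (6*(l*d+i)+1) * \<zeta>^(2*(l*d+i)) * (\<Prod>j<i. pfac (l*d+j) \<zeta>))) (disc_at \<zeta>)"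
      unfolding I_def by (intro tendsto_intros id_tendsto qint_tendsto pfac_lim) auto
    also have "(\<Sum>i<d. qint \<zeta> (6*(l*d+i)+1) * \<zeta>^(2*(l*d+i)) * (\<Prod>j<i. pfac (l*d+j) \<zeta>)) = deformed_sum d \<zeta> 0 0"
      unfolding deformed_sum_def term_eq qint_def per pfac_per ..
    finally show ?thesis by (simp only: deformed_sum_0)
  qed
  then have "((\<lambda>q. \<Sum>l<M. (\<Prod>j<l*d. pfac j q) * I l q) \<longlongrightarrow> (\<Sum>l<M. 0)) (disc_at \<zeta>)"
    by (intro tendsto_sum tendsto_0_bounded_mult prod_pfac_bounded)
  then show ?thesis unfolding eq by simp
qed

end

subsection \<open>Rational functions and their values on the disc\<close>

text \<open>
  On the punctured open unit disc all denominators that occur are nonzero, and it still touches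
  every root of unity; so divisibility by a power of \<open>q - \<zeta>\<close> can be read off from the growth at \<open>\<zeta>\<close>
  of the values on the disc.
\<close>

definition evaluates :: "complex poly fract \<Rightarrow> (complex \<Rightarrow> complex) \<Rightarrow> bool"
  where "evaluates f g \<longleftrightarrow> (\<exists>a b. f = Fraction_Field.Fract a b \<and>
    (\<forall>q. q \<noteq> 0 \<longrightarrow> norm q < 1 \<longrightarrow> poly b q \<noteq> 0 \<and> g q = poly a q / poly b q))"

lemma evaluatesE:
  assumes "evaluates f g"
  obtains a b where "f = Fraction_Field.Fract a b" "b \<noteq> 0"
    "\<forall>q. q \<noteq> 0 \<longrightarrow> norm q < 1 \<longrightarrow> poly b q \<noteq> 0 \<and> g q = poly a q / poly b q"
proof -
  obtain a b where *: "f = Fraction_Field.Fract a b"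
    "\<forall>q. q \<noteq> 0 \<longrightarrow> norm q < 1 \<longrightarrow> poly b q \<noteq> 0 \<and> g q = poly a q / poly b q"
    using assms unfolding evaluates_def by blast
  \<comment> \<open>The point \<open>1/2\<close> is merely some element of the punctured
    disc.\<close>
  have "b \<noteq> 0" using *(2)[rule_format, of "1/2"] by auto
  with * show ?thesis by (intro that)
qed

lemma evaluates_qvar: "evaluates qvar (\<lambda>q. q)"
  unfolding evaluates_def qvar_def by (intro exI[of _ "[:0,1:]"] exI[of _ 1]) simp

lemma evaluates_0: "evaluates 0 (\<lambda>q. 0)"
  unfolding evaluates_def Zero_fract_def by (intro exI[of _ 0] exI[of _ 1]) simp

lemma evaluates_1: "evaluates 1 (\<lambda>q. 1)"
  unfolding evaluates_def One_fract_def by (intro exI[of _ 1] exI[of _ 1]) simp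

lemma evaluates_add:
  assumes "evaluates f1 g1" "evaluates f2 g2"
  shows "evaluates (f1 + f2) (\<lambda>q. g1 q + g2 q)"
proof -
  from assms(1) obtain a b where 1: "f1 = Fraction_Field.Fract a b" "b \<noteq> 0"
    "\<forall>q. q \<noteq> 0 \<longrightarrow> norm q < 1 \<longrightarrow> poly b q \<noteq> 0 \<and> g1 q = poly a q / poly b q" by (rule evaluatesE)
  from assms(2) obtain c d where 2: "f2 = Fraction_Field.Fract c d" "d \<noteq> 0"
    "\<forall>q. q \<noteq> 0 \<longrightarrow> norm q < 1 \<longrightarrow> poly d q \<noteq> 0 \<and> g2 q = poly c q / poly d q" by (rule evaluatesE)
  have "f1 + f2 = Fraction_Field.Fract (a * d + c * b) (b * d)"
    using 1 2 by simp
  moreover have "poly (b * d) q \<noteq> 0 \<and> g1 q + g2 q = poly (a * d + c * b) q / poly (b * d) q"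
    if "q \<noteq> 0" "norm q < 1" for q
    using 1(3) 2(3) that by (simp add: add_frac_eq)
  ultimately show ?thesis unfolding evaluates_def by blast
qed

lemma evaluates_mult:
  assumes "evaluates f1 g1" "evaluates f2 g2"
  shows "evaluates (f1 * f2) (\<lambda>q. g1 q * g2 q)"
proof -
  from assms(1) obtain a b where 1: "f1 = Fraction_Field.Fract a b" "b \<noteq> 0"
    "\<forall>q. q \<noteq> 0 \<longrightarrow> norm q < 1 \<longrightarrow> poly b q \<noteq> 0 \<and> g1 q = poly a q / poly b q" by (rule evaluatesE)
  from assms(2) obtain c d where 2: "f2 = Fraction_Field.Fract c d" "d \<noteq> 0"
    "\<forall>q. q \<noteq> 0 \<longrightarrow> norm q < 1 \<longrightarrow> poly d q \<noteq> 0 \<and> g2 q = poly c q / poly d q" by (rule evaluatesE)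
  have "f1 * f2 = Fraction_Field.Fract (a * c) (b * d)"
    using 1 2 by simp
  moreover have "poly (b * d) q \<noteq> 0 \<and> g1 q * g2 q = poly (a * c) q / poly (b * d) q"
    if "q \<noteq> 0" "norm q < 1" for q
    using 1(3) 2(3) that by simp
  ultimately show ?thesis unfolding evaluates_def by blast
qed

lemma evaluates_minus:
  assumes "evaluates f g"
  shows "evaluates (- f) (\<lambda>q. - g q)"
proof -
  from assms obtain a b where 1: "f = Fraction_Field.Fract a b" "b \<noteq> 0"
    "\<forall>q. q \<noteq> 0 \<longrightarrow> norm q < 1 \<longrightarrow> poly b q \<noteq> 0 \<and> g q = poly a q / poly b q" by (rule evaluatesE)
  then show ?thesis
    unfolding evaluates_def by (intro exI[of _ "-a"] exI[of _ b]) simp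
qed

lemma evaluates_inverse:
  assumes "evaluates f g" and nz: "\<And>q. q \<noteq> 0 \<Longrightarrow> norm q < 1 \<Longrightarrow> g q \<noteq> 0"
  shows "evaluates (inverse f) (\<lambda>q. inverse (g q))"
proof -
  from assms(1) obtain a b where 1: "f = Fraction_Field.Fract a b" "b \<noteq> 0"
    "\<forall>q. q \<noteq> 0 \<longrightarrow> norm q < 1 \<longrightarrow> poly b q \<noteq> 0 \<and> g q = poly a q / poly b q" by (rule evaluatesE)
  have "inverse f = Fraction_Field.Fract b a" using 1 by simp
  moreover have "poly a q \<noteq> 0 \<and> inverse (g q) = poly b q / poly a q" if "q \<noteq> 0" "norm q < 1" for q
    using 1(3) nz[OF that] that by auto
  ultimately show ?thesis unfolding evaluates_def by blast
qed

lemma evaluates_diff: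
  "evaluates f1 g1 \<Longrightarrow> evaluates f2 g2 \<Longrightarrow> evaluates (f1 - f2) (\<lambda>q. g1 q - g2 q)"
  using evaluates_add[of f1 g1 "- f2" "\<lambda>q. - g2 q"] evaluates_minus[of f2 g2] by simp

lemma evaluates_divide:
  "evaluates f1 g1 \<Longrightarrow> evaluates f2 g2 \<Longrightarrow> (\<And>q. q \<noteq> 0 \<Longrightarrow> norm q < 1 \<Longrightarrow> g2 q \<noteq> 0) \<Longrightarrow>
    evaluates (f1 / f2) (\<lambda>q. g1 q / g2 q)"
  unfolding divide_inverse by (intro evaluates_mult evaluates_inverse)

lemma evaluates_power: "evaluates f g \<Longrightarrow> evaluates (f ^ k) (\<lambda>q. g q ^ k)"
  by (induction k) (auto intro: evaluates_1 evaluates_mult)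

lemma evaluates_sum: "(\<And>x. x \<in> A \<Longrightarrow> evaluates (f x) (g x)) \<Longrightarrow> evaluates (\<Sum>x\<in>A. f x) (\<lambda>q. \<Sum>x\<in>A. g x q)"
  by (induction A rule: infinite_finite_induct) (auto intro: evaluates_0 evaluates_add)

lemma evaluates_prod: "(\<And>x. x \<in> A \<Longrightarrow> evaluates (f x) (g x)) \<Longrightarrow> evaluates (\<Prod>x\<in>A. f x) (\<lambda>q. \<Prod>x\<in>A. g x q)"
  by (induction A rule: infinite_finite_induct) (auto intro: evaluates_1 evaluates_mult)

lemma evaluates_numeral_2: "evaluates 2 (\<lambda>q. 2)"
  using evaluates_add[OF evaluates_1 evaluates_1] by simp

lemma evaluates_qint: "evaluates (qint qvar r) (\<lambda>q. qint q r)"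
  unfolding qint_def
  by (intro evaluates_divide evaluates_diff evaluates_1 evaluates_power evaluates_qvar) auto

lemma evaluates_qpoch:
  "evaluates f1 g1 \<Longrightarrow> evaluates f2 g2 \<Longrightarrow> evaluates (qpoch f1 f2 k) (\<lambda>q. qpoch (g1 q) (g2 q) k)"
  unfolding qpoch_def
  by (intro evaluates_prod evaluates_diff evaluates_1 evaluates_mult evaluates_power)

section \<open>Coprimality and divisibility of complex polynomials through their roots\<close>

lemma coprime_complex_poly_iff:
  fixes a b :: "complex poly"
  assumes "b \<noteq> 0"
  shows "coprime a b \<longleftrightarrow> (\<forall>z. poly a z = 0 \<longrightarrow> poly b z \<noteq> 0)"
proof
  assume "coprime a b"
  then show "\<forall>z. poly a z = 0 \<longrightarrow> poly b z \<noteq> 0"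
  proof (intro allI impI notI)
    fix z assume "coprime a b" "poly a z = 0" "poly b z = 0"
    then have "is_unit [:-z, 1:]"
      by (intro coprime_common_divisor[of a b]) (simp_all only: poly_eq_0_iff_dvd)
    then show False by (simp add: is_unit_pCons_iff)
  qed
next
  assume *: "\<forall>z. poly a z = 0 \<longrightarrow> poly b z \<noteq> 0"
  show "coprime a b"
  proof (rule coprimeI)
    fix c assume c: "c dvd a" "c dvd b"
    have "c \<noteq> 0" using c assms by auto
    have "degree c = 0"
    proof (rule ccontr)
      assume "degree c \<noteq> 0"
      then obtain z where "poly c z = 0"
        using Fundamental_Theorem_Algebra.fundamental_theorem_of_algebra[of c] by (auto simp: constant_degree)
      then have "poly a z = 0" "poly b z = 0" using c by (auto elim!: dvdE)
      then show False using * by blast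
    qed
    then show "is_unit c" using \<open>c \<noteq> 0\<close> by (simp add: is_unit_iff_degree)
  qed
qed

lemma complex_poly_dvd_of_order_le:
  fixes p a :: "complex poly"
  assumes "p \<noteq> 0" "a \<noteq> 0" "\<And>z. order z p \<le> order z a"
  shows "p dvd a"
  using assms
proof (induction "degree p" arbitrary: p a rule: less_induct)
  case less
  show ?case
  proof (cases "degree p = 0")
    case True
    then have "is_unit p" using less(2) by (simp add: is_unit_iff_degree)
    then show ?thesis by (rule unit_imp_dvd)
  next
    case False
    then obtain z where z: "poly p z = 0"
      using Fundamental_Theorem_Algebra.fundamental_theorem_of_algebra[of p] by (auto simp: constant_degree)
    then have "order z a \<noteq> 0" using less(2) less(4)[of z] by (auto simp: order_root)
    then have "poly a z = 0" by (simp add: order_root)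
    then obtain p1 a1 where eq: "p = [:-z, 1:] * p1" "a = [:-z, 1:] * a1"
      using z by (auto simp: poly_eq_0_iff_dvd elim!: dvdE)
    have nz: "p1 \<noteq> 0" "a1 \<noteq> 0" using less(2,3) eq by auto
    have "degree p1 < degree p" unfolding eq(1) using nz by (subst degree_mult_eq) auto
    moreover have "order w p1 \<le> order w a1" for w
    proof -
      have "order w p = order w [:-z, 1:] + order w p1" "order w a = order w [:-z, 1:] + order w a1"
        using less(2,3) unfolding eq by (simp_all only: order_mult not_False_eq_True)
      then show ?thesis using less(4)[of w] by linarith
    qed
    ultimately have "p1 dvd a1" using nz by (intro less(1))
    then show ?thesis unfolding eq by (intro mult_dvd_mono dvd_refl)
  qed
qed

lemma complex_poly_dvdI:
  fixes p a :: "complex poly"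
  assumes "p \<noteq> 0" and dvd: "\<And>z. poly p z = 0 \<Longrightarrow> [:-z, 1:] ^ order z p dvd a"
  shows "p dvd a"
proof (cases "a = 0")
  case False
  have "order z p \<le> order z a" for z
  proof (cases "poly p z = 0")
    case True
    then show ?thesis using dvd[of z] False by (simp add: order_divides)
  qed (simp add: order_0I)
  then show ?thesis by (intro complex_poly_dvd_of_order_le assms(1) False)
qed simp

text \<open>Common linear factors are cancelled until none is left, which lowers the degree of the
  denominator. The cross product equation is kept because it passes to values on the disc.\<close>

lemma fract_coprime:
  fixes a b :: "complex poly"
  assumes "b \<noteq> 0"
  shows "\<exists>a' b'. Fraction_Field.Fract a b = Fraction_Field.Fract a' b' \<and> coprime a' b' \<and> b' \<noteq> 0 \<and> a * b' = a' * b"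
  using assms
proof (induction "degree b" arbitrary: a b rule: less_induct)
  case less
  show ?case
  proof (cases "coprime a b")
    case True
    then show ?thesis using less(2) by blast
  next
    case False
    then obtain z where "poly a z = 0" "poly b z = 0"
      using coprime_complex_poly_iff[OF less(2), of a] by blast
    then obtain a1 b1 where eq: "a = [:-z, 1:] * a1" "b = [:-z, 1:] * b1"
      by (auto simp: poly_eq_0_iff_dvd elim!: dvdE)
    have nz: "b1 \<noteq> 0" using less(2) eq by auto
    have "degree b1 < degree b" unfolding eq(2) using nz by (subst degree_mult_eq) auto
    then obtain a' b' where *: "Fraction_Field.Fract a1 b1 = Fraction_Field.Fract a' b'" "coprime a' b'" "b' \<noteq> 0" "a1 * b' = a' * b1"
      using less(1)[of b1 a1] nz by blast
    have "a * b' = a' * b" unfolding eq using *(4) by (simp only: mult.assoc mult.left_commute)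
    then show ?thesis using * less(2) by (metis eq_fract(1))
  qed
qed

lemma evaluates_normal_form:
  assumes "evaluates f g"
  obtains a b where "f = Fraction_Field.Fract a b" "b \<noteq> 0" "coprime a b"
    "\<And>q. q \<noteq> 0 \<Longrightarrow> norm q < 1 \<Longrightarrow> g q * poly b q = poly a q"
proof -
  from assms obtain a0 b0 where 0: "f = Fraction_Field.Fract a0 b0" "b0 \<noteq> 0"
    "\<forall>q. q \<noteq> 0 \<longrightarrow> norm q < 1 \<longrightarrow> poly b0 q \<noteq> 0 \<and> g q = poly a0 q / poly b0 q" by (rule evaluatesE)
  obtain a b where 1: "Fraction_Field.Fract a0 b0 = Fraction_Field.Fract a b" "coprime a b" "b \<noteq> 0" "a0 * b = a * b0"
    using fract_coprime[OF 0(2)] by blast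
  have "g q * poly b q = poly a q" if "q \<noteq> 0" "norm q < 1" for q
  proof -
    have "poly a0 q * poly b q = poly a q * poly b0 q" using 1(4) by (metis poly_mult)
    then show ?thesis using 0(3) that by (simp add: field_simps)
  qed
  then show ?thesis using that[of a b] 0 1 by simp
qed

lemma tendsto_poly_disc_at: "((\<lambda>q. poly p q) \<longlongrightarrow> poly p \<zeta>) (disc_at \<zeta>)"
  by (intro tendsto_poly tendsto_ident_at)

text \<open>If \<open>b\<close> vanished at \<open>\<zeta>\<close>, then \<open>a = g * b\<close>
  would tend to zero as well, giving a common root of coprime polynomials.\<close>

lemma bounded_imp_denominator_ne_0:
  assumes ab: "coprime a b" "b \<noteq> 0" "\<And>q. q \<noteq> 0 \<Longrightarrow> norm q < 1 \<Longrightarrow> g q * poly b q = poly a q"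
    and \<zeta>: "norm \<zeta> = 1" and g: "g \<in> O[disc_at \<zeta>](\<lambda>_. 1)"
  shows "poly b \<zeta> \<noteq> 0"
proof
  assume b: "poly b \<zeta> = 0"
  have "poly b \<in> o[disc_at \<zeta>](\<lambda>_. 1)"
    using tendsto_poly_disc_at[of b \<zeta>] b by (intro smalloI_tendsto) auto
  then have "(\<lambda>q. g q * poly b q) \<in> o[disc_at \<zeta>](\<lambda>_. 1 * 1)"
    by (rule landau_o.big_small_mult[OF g])
  then have "((\<lambda>q. g q * poly b q) \<longlongrightarrow> 0) (disc_at \<zeta>)"
    using smalloD_tendsto[of "\<lambda>q. g q * poly b q" "disc_at \<zeta>" "\<lambda>_. 1"] by simp
  moreover have "eventually (\<lambda>q. g q * poly b q = poly a q) (disc_at \<zeta>)"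
    using eventually_disc_at by eventually_elim (use ab in auto)
  ultimately have "(poly a \<longlongrightarrow> 0) (disc_at \<zeta>)"
    by (rule Lim_transform_eventually)
  then have "poly a \<zeta> = 0"
    by (rule tendsto_unique[OF disc_at_neq_bot[OF \<zeta>] tendsto_poly_disc_at])
  then show False using b ab coprime_complex_poly_iff[of b a] by auto
qed

text \<open>If \<open>a\<close> had order \<open>r \<le> m\<close> at \<open>\<zeta>\<close>, its
  cofactor after removing \<open>(q - \<zeta>)^r\<close> would still tend to zero. A zero limit,
  rather than mere boundedness, accounts for the exponent \<open>Suc m\<close>.\<close>

lemma vanishing_imp_power_dvd:
  assumes ab: "\<And>q. q \<noteq> 0 \<Longrightarrow> norm q < 1 \<Longrightarrow> g q * poly b q = poly a q"
    and \<zeta>: "norm \<zeta> = 1" and g: "((\<lambda>q. g q / (q - \<zeta>) ^ m) \<longlongrightarrow> 0) (disc_at \<zeta>)"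
  shows "[:-\<zeta>, 1:] ^ Suc m dvd a"
proof (cases "a = 0")
  case False
  define r where "r = order \<zeta> a"
  have "r > m"
  proof (rule ccontr)
    assume "\<not> r > m"
    then have r: "m = r + (m - r)" by simp
    obtain c where c: "a = [:-\<zeta>, 1:] ^ r * c" using order_1[of \<zeta> a] unfolding r_def by (auto elim: dvdE)
    have "((\<lambda>q. g q / (q - \<zeta>) ^ m * ((q - \<zeta>) ^ (m - r) * poly b q)) \<longlongrightarrow> 0 * ((\<zeta> - \<zeta>) ^ (m - r) * poly b \<zeta>)) (disc_at \<zeta>)"
      by (intro tendsto_intros g tendsto_poly_disc_at)
    moreover have "eventually (\<lambda>q. q \<noteq> \<zeta>) (disc_at \<zeta>)" by (simp add: eventually_at_filter)
    then have "eventually (\<lambda>q. g q / (q - \<zeta>) ^ m * ((q - \<zeta>) ^ (m - r) * poly b q) = poly c q) (disc_at \<zeta>)"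
      using eventually_disc_at
    proof eventually_elim
      case (elim q)
      have "g q * poly b q = (q - \<zeta>) ^ r * poly c q"
        using ab[of q] elim unfolding c by simp
      moreover have "(q - \<zeta>) ^ m = (q - \<zeta>) ^ r * (q - \<zeta>) ^ (m - r)"
        by (subst r) (rule power_add)
      ultimately show ?case using elim(1) by (simp add: field_simps)
    qed
    ultimately have "(poly c \<longlongrightarrow> 0) (disc_at \<zeta>)"
      by (simp add: Lim_transform_eventually)
    then have "poly c \<zeta> = 0"
      by (rule tendsto_unique[OF disc_at_neq_bot[OF \<zeta>] tendsto_poly_disc_at])
    then have "[:-\<zeta>, 1:] ^ Suc r dvd a"
      unfolding c poly_eq_0_iff_dvd power_Suc2 by (intro mult_dvd_mono dvd_refl)
    then show False using order_2[OF False, of \<zeta>] by (simp add: r_def)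
  qed
  then have "[:-\<zeta>, 1:] ^ Suc m dvd [:-\<zeta>, 1:] ^ r"
    by (intro le_imp_power_dvd) simp
  then show ?thesis
    using order_1[of \<zeta> a] unfolding r_def by (rule dvd_trans)
qed simp

lemma denom_coprimeI:
  assumes f: "evaluates f g" and "P \<noteq> 0"
    and P: "\<And>\<zeta>. poly P \<zeta> = 0 \<Longrightarrow> norm \<zeta> = 1" "\<And>\<zeta>. poly P \<zeta> = 0 \<Longrightarrow> g \<in> O[disc_at \<zeta>](\<lambda>_. 1)"
  shows "denom_coprime f P"
proof -
  obtain a b where ab: "f = Fraction_Field.Fract a b" "b \<noteq> 0" "coprime a b"
    "\<And>q. q \<noteq> 0 \<Longrightarrow> norm q < 1 \<Longrightarrow> g q * poly b q = poly a q"
    using evaluates_normal_form[OF f] by metis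
  have "coprime b P"
    using bounded_imp_denominator_ne_0[OF ab(3,2,4)] P by (subst coprime_complex_poly_iff[OF \<open>P \<noteq> 0\<close>]) blast
  then show ?thesis using ab unfolding denom_coprime_def by blast
qed

lemma ratfun_congI:
  assumes A: "evaluates A gA" and B: "evaluates B gB" and "P \<noteq> 0"
    and P: "\<And>\<zeta>. poly P \<zeta> = 0 \<Longrightarrow> norm \<zeta> = 1"
    and gA: "\<And>\<zeta>. poly P \<zeta> = 0 \<Longrightarrow> gA \<in> O[disc_at \<zeta>](\<lambda>_. 1)"
    and gB: "\<And>\<zeta>. poly P \<zeta> = 0 \<Longrightarrow> gB \<in> O[disc_at \<zeta>](\<lambda>_. 1)"
    and lim: "\<And>\<zeta>. poly P \<zeta> = 0 \<Longrightarrow> \<exists>m. order \<zeta> P \<le> Suc m \<and>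
      ((\<lambda>q. (gA q - gB q) / (q - \<zeta>) ^ m) \<longlongrightarrow> 0) (disc_at \<zeta>)"
  shows "ratfun_cong A B P"
proof -
  obtain a b where ab: "A - B = Fraction_Field.Fract a b" "b \<noteq> 0" "coprime a b"
    "\<And>q. q \<noteq> 0 \<Longrightarrow> norm q < 1 \<Longrightarrow> (gA q - gB q) * poly b q = poly a q"
    using evaluates_normal_form[OF evaluates_diff[OF A B]] by metis
  have "(\<lambda>q. gA q - gB q) \<in> O[disc_at \<zeta>](\<lambda>_. 1)" if "poly P \<zeta> = 0" for \<zeta>
    using gA[OF that] gB[OF that] by (rule sum_in_bigo)
  then have "coprime b P"
    using bounded_imp_denominator_ne_0[OF ab(3,2,4)] P by (subst coprime_complex_poly_iff[OF \<open>P \<noteq> 0\<close>]) blast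
  moreover have "P dvd a"
  proof (rule complex_poly_dvdI[OF \<open>P \<noteq> 0\<close>])
    fix \<zeta> assume \<zeta>: "poly P \<zeta> = 0"
    obtain m where m: "order \<zeta> P \<le> Suc m" "((\<lambda>q. (gA q - gB q) / (q - \<zeta>) ^ m) \<longlongrightarrow> 0) (disc_at \<zeta>)"
      using lim[OF \<zeta>] by blast
    have "[:-\<zeta>, 1:] ^ Suc m dvd a"
      by (rule vanishing_imp_power_dvd[OF ab(4) P[OF \<zeta>] m(2)])
    then show "[:-\<zeta>, 1:] ^ order \<zeta> P dvd a"
      using m(1) by (rule power_le_dvd)
  qed
  moreover have "denom_coprime A P" "denom_coprime B P"
    using denom_coprimeI[OF A \<open>P \<noteq> 0\<close> P gA] denom_coprimeI[OF B \<open>P \<noteq> 0\<close> P gB] by blast+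
  ultimately show ?thesis using ab unfolding ratfun_cong_def by blast
qed

subsection \<open>The roots of the modulus\<close>

lemma qint_poly_mult: "qint [:0, 1:] n * (1 - [:0, 1:]) = 1 - [:0, 1 :: complex:] ^ n"
proof -
  have "(1 - [:0, 1 :: complex:]) dvd 1 - [:0, 1:] ^ n"
    unfolding one_diff_power_eq[of "[:0, 1:]"] by simp
  then show ?thesis unfolding qint_def by (rule dvd_div_mult_self)
qed

lemma order_one_minus_power:
  fixes \<zeta> :: complex
  assumes "\<zeta> ^ n = 1" "n > 0"
  shows "1 - [:0, 1:] ^ n \<noteq> (0 :: complex poly)" "order \<zeta> (1 - [:0, 1:] ^ n) = 1"
proof -
  define F where "F = 1 - [:0, 1 :: complex:] ^ n"
  have "\<zeta> \<noteq> 0" using assms by (auto simp: power_0_left)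
  have "pderiv F = - smult (of_nat n) ([:0, 1:] ^ (n - 1))"
    using \<open>n > 0\<close> by (cases n) (simp_all add: F_def pderiv_diff pderiv_power_Suc pderiv_pCons del: power_Suc of_nat_Suc)
  then have "poly (pderiv F) \<zeta> \<noteq> 0"
    using assms \<open>\<zeta> \<noteq> 0\<close> by simp
  then have "order \<zeta> (pderiv F) = 0" by (rule order_0I)
  moreover have "F \<noteq> 0" using \<open>poly (pderiv F) \<zeta> \<noteq> 0\<close> by auto
  moreover have "poly F \<zeta> = 0" using assms by (simp add: F_def)
  ultimately show "1 - [:0, 1:] ^ n \<noteq> (0 :: complex poly)" "order \<zeta> (1 - [:0, 1:] ^ n) = 1"
    using order_pderiv[of F \<zeta>] by (simp_all add: F_def)
qed

lemma qint_poly_ne_0: "n > 0 \<Longrightarrow> qint [:0, 1 :: complex:] n \<noteq> 0"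
  using qint_poly_mult[of n] order_one_minus_power(1)[of 1 n] by auto

lemma qint_poly_root:
  fixes \<zeta> :: complex
  assumes "n > 0" "poly (qint [:0, 1:] n) \<zeta> = 0"
  shows "\<zeta> ^ n = 1" "\<zeta> \<noteq> 1"
proof -
  have "poly (qint [:0, 1:] n * (1 - [:0, 1:])) \<zeta> = 0" using assms by simp
  then show *: "\<zeta> ^ n = 1" unfolding qint_poly_mult by simp
  show "\<zeta> \<noteq> 1"
  proof
    assume "\<zeta> = 1"
    \<comment> \<open>At \<open>1\<close> the product \<open>1 - q^n\<close> has only a simple zero,
      which the factor \<open>1 - q\<close> already uses up.\<close>
    have nz: "qint [:0, 1:] n * (1 - [:0, 1 :: complex:]) \<noteq> 0"
      unfolding qint_poly_mult by (rule order_one_minus_power(1)[OF * assms(1)])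
    have "order \<zeta> (qint [:0, 1:] n) > 0" "order \<zeta> (1 - [:0, 1:]) > 0"
      using assms qint_poly_ne_0[OF assms(1)] \<open>\<zeta> = 1\<close> by (simp_all add: order_gt_0_iff one_pCons)
    then show False
      using order_mult[OF nz, of \<zeta>] order_one_minus_power(2)[OF * assms(1)] unfolding qint_poly_mult by simp
  qed
qed

lemma order_qint_poly:
  fixes \<zeta> :: complex
  assumes "n > 0" "\<zeta> ^ n = 1"
  shows "order \<zeta> (qint [:0, 1:] n) \<le> 1"
proof -
  have "qint [:0, 1:] n * (1 - [:0, 1 :: complex:]) \<noteq> 0"
    unfolding qint_poly_mult by (rule order_one_minus_power(1)[OF assms(2,1)])
  then show ?thesis
    using order_mult[of "qint [:0, 1:] n" "1 - [:0, 1:]" \<zeta>] order_one_minus_power(2)[OF assms(2,1)]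
    unfolding qint_poly_mult by simp
qed

lemma order_prod_linear:
  fixes c :: "'b \<Rightarrow> complex"
  assumes "finite S"
  shows "order z (\<Prod>k\<in>S. [:- c k, 1:]) = card {k\<in>S. c k = z}"
  using assms
proof (induction S rule: finite_induct)
  case (insert x S)
  have nz: "[:- c x, 1:] * (\<Prod>k\<in>S. [:- c k, 1:]) \<noteq> 0"
    using insert(1) by (intro no_zero_divisors) simp_all
  have "{k\<in>insert x S. c k = z} = (if c x = z then insert x {k\<in>S. c k = z} else {k\<in>S. c k = z})"
    by auto
  moreover have "order z [:- c x, 1:] = (if c x = z then 1 else 0)"
    using order_power_n_n[of z 1] by (auto intro: order_0I)
  ultimately show ?case
    using insert order_mult[OF nz, of z] by simp
qed simp

lemma cyclotomic_ne_0: "cyclotomic n \<noteq> 0"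
  by (simp add: cyclotomic_def)

lemma order_cyclotomic:
  assumes "n > 1"
  shows "order z (cyclotomic n) \<le> 1"
proof -
  let ?S = "{k. 1 \<le> k \<and> k \<le> n \<and> coprime k n}" and ?c = "\<lambda>k. cis (2 * pi * real k / real n)"
  \<comment> \<open>For \<open>n > 1\<close> the index \<open>k = n\<close> is not coprime to
    \<open>n\<close>, so each root of unity is listed at most once.\<close>
  have "?S \<subseteq> {..<n}" using assms by (auto simp: nat_less_le)
  moreover have "inj_on ?c {..<n}" using Complex.bij_betw_roots_unity[of n] assms by (simp add: bij_betw_def)
  ultimately have inj: "inj_on ?c ?S" by (rule inj_on_subset[rotated])
  have "finite ?S" by simp
  then have "order z (cyclotomic n) = card {k\<in>?S. ?c k = z}"
    unfolding cyclotomic_def by (rule order_prod_linear)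
  also have "\<dots> \<le> 1"
    using inj by (intro card_le_Suc0_iff_eq[THEN iffD2, simplified One_nat_def[symmetric]]) (auto dest: inj_onD)
  finally show ?thesis .
qed

lemma cyclotomic_root:
  assumes "n > 1" "poly (cyclotomic n) z = 0"
  shows "z ^ n = 1" "\<And>j. z ^ j = 1 \<Longrightarrow> n dvd j"
proof -
  obtain k where k: "coprime k n" "z = cis (2 * pi * real k / real n)"
    using assms by (auto simp: cyclotomic_def poly_prod)
  show "z ^ n = 1"
    using assms(1) unfolding k(2) Complex.DeMoivre
    by (simp add: cis_multiple_2pi)
  fix j assume "z ^ j = 1"
  then have "cos (real j * (2 * pi * real k / real n)) = 1"
    unfolding k(2) Complex.DeMoivre by (metis cis.sel(1) one_complex.sel(1))
  then obtain i :: int where "real j * (2 * pi * real k / real n) = i * 2 * pi"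
    by (auto simp: cos_one_2pi_int)
  then have "real j * real k = i * real n" using assms(1) by (simp add: field_simps)
  then have "int j * int k = i * int n" by (metis of_int_eq_iff of_int_mult of_int_of_nat_eq)
  then have "int n dvd int (j * k)" by simp
  then have "n dvd j * k" by (simp only: int_dvd_int_iff)
  then show "n dvd j" using k(1) by (simp add: coprime_dvd_mult_left_iff coprime_commute)
qed

section \<open>From local estimates at the roots to the congruence\<close>

lemma odd_root_exists:
  fixes \<zeta> :: complex
  assumes "\<zeta> ^ n = 1" "\<zeta> \<noteq> 1" "odd n"
  obtains d where "odd_root \<zeta> d" "d dvd n"
proof -
  define d where "d = (LEAST j. j > 0 \<and> \<zeta> ^ j = 1)"
  have "n > 0" using \<open>odd n\<close> by (rule odd_pos)
  then have d: "d > 0" "\<zeta> ^ d = 1"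
    using LeastI[of "\<lambda>j. j > 0 \<and> \<zeta> ^ j = 1" n] assms(1) by (simp_all add: d_def)
  have root: "\<zeta> ^ j = 1 \<longleftrightarrow> d dvd j" for j
  proof
    assume "\<zeta> ^ j = 1"
    moreover have "\<zeta> ^ j = \<zeta> ^ (d * (j div d)) * \<zeta> ^ (j mod d)" by (simp flip: power_add)
    ultimately have "\<zeta> ^ (j mod d) = 1" using d(2) by (simp add: power_mult)
    then show "d dvd j"
      using not_less_Least[of "j mod d" "\<lambda>j. j > 0 \<and> \<zeta> ^ j = 1"] d(1)
      unfolding d_def[symmetric] by (auto simp: dvd_eq_mod_eq_0)
  next
    assume "d dvd j"
    then show "\<zeta> ^ j = 1" using d(2) by (auto simp: power_mult elim!: dvdE)
  qed
  have "d dvd n" using root assms(1) by simp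
  moreover have "odd d" using \<open>d dvd n\<close> assms(3) by (auto dest: dvd_trans)
  moreover have "d > 1" using d(1) root[of 1] assms(2) by (cases "d = 1") auto
  ultimately show ?thesis using that[of d] root by (simp add: odd_root_def)
qed

text \<open>\<open>X = 0\<close> is the case \<open>x = 1\<close> of
  \<open>quad_ratio_qpoch\<close>, where the paired factors become squares.\<close>

lemma deformed_sum_0_0:
  "deformed_sum n q 0 0 = (\<Sum>k<n. qint q (6 * k + 1) *
      (qpoch q (q ^ 2) k ^ 2 * qpoch (q ^ 2) (q ^ 4) k * qpoch q (q ^ 4) k ^ 2 /
       (qpoch (q ^ 2) (q ^ 2) k ^ 2 * qpoch (q ^ 4) (q ^ 4) k ^ 3)) * q ^ (2 * k))"
  using quad_ratio_qpoch[of 1 2 1 4 4 _ q] quad_ratio_qpoch[of 1 4 1 2 2 _ q]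
  by (simp add: deformed_sum_def coef_qpoch qint_def power2_eq_square power3_eq_cube mult_ac)

lemma rhs_qpoch:
  "rhs n q = qint q (3 * n) * (q ^ (2 * n) * (2 - q ^ n) / (1 + q ^ n) ^ 2) *
    (qpoch (q ^ 2) (q ^ 4) ((3 * n - 1) div 4) ^ 2 / qpoch (q ^ 4) (q ^ 4) ((3 * n - 1) div 4) ^ 2)"
  using quad_ratio_qpoch[of 1 4 2 4 4 "(3 * n - 1) div 4" q]
  by (simp add: rhs_def power2_eq_square)

theorem theorem1p3:
  fixes n :: nat
  assumes "n > 0" and "[n = 3] (mod 4)"
  shows "ratfun_cong
    (\<Sum>k = 0..n - 1.
      qint qvar (6 * k + 1) *
      (qpoch qvar (qvar ^ 2) k ^ 2 * qpoch (qvar ^ 2) (qvar ^ 4) k * qpoch qvar (qvar ^ 4) k ^ 2 /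
       (qpoch (qvar ^ 2) (qvar ^ 2) k ^ 2 * qpoch (qvar ^ 4) (qvar ^ 4) k ^ 3)) *
      qvar ^ (2 * k))
    (qint qvar (3 * n) *
      (qvar ^ (2 * n) * (2 - qvar ^ n) / (1 + qvar ^ n) ^ 2) *
      (qpoch (qvar ^ 2) (qvar ^ 4) ((3 * n - 1) div 4) ^ 2 /
       qpoch (qvar ^ 4) (qvar ^ 4) ((3 * n - 1) div 4) ^ 2))
    (qint [:0, 1:] n * cyclotomic n ^ 4)"
proof -
  define P where "P = qint [:0, 1:] n * cyclotomic n ^ 4"
  have "n mod 4 = 3" using assms(2) by (simp add: unique_euclidean_semiring_class.cong_def)
  then have n: "n = 4 * (n div 4) + 3" "odd n" "n > 1" by presburger+
  have "P \<noteq> 0" using qint_poly_ne_0[OF assms(1)] cyclotomic_ne_0 by (simp add: P_def)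
  have qpoch_nz: "qpoch (q ^ Suc i) (q ^ Suc i) k \<noteq> 0" if "q \<noteq> 0" "norm q < 1" for q :: complex and i k
    unfolding qpoch_eq_0_iff using power_ne_1_of_norm_less_1[OF that]
    by (simp flip: power_mult power_add del: power_Suc)
  have plus_nz: "1 + q ^ n \<noteq> 0" if "q \<noteq> 0" "norm q < 1" for q :: complex
  proof -
    have "norm (q ^ n) < 1" using that n by (simp add: norm_power power_less_one_iff)
    then show ?thesis by (metis add_eq_0_iff norm_minus_cancel norm_one less_irrefl)
  qed
  have set: "{0..n - 1} = {..<n}" using n by auto
  have A: "evaluates (\<Sum>k = 0..n - 1.
      qint qvar (6 * k + 1) *
      (qpoch qvar (qvar ^ 2) k ^ 2 * qpoch (qvar ^ 2) (qvar ^ 4) k * qpoch qvar (qvar ^ 4) k ^ 2 /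
       (qpoch (qvar ^ 2) (qvar ^ 2) k ^ 2 * qpoch (qvar ^ 4) (qvar ^ 4) k ^ 3)) *
      qvar ^ (2 * k)) (\<lambda>q. deformed_sum n q 0 0)"
    unfolding deformed_sum_0_0 set
    by (intro evaluates_sum evaluates_mult evaluates_divide evaluates_power evaluates_qpoch evaluates_qint evaluates_qvar)
       (use qpoch_nz[of _ 1] qpoch_nz[of _ 3] in \<open>simp add: power2_eq_square\<close>)
  have B: "evaluates (qint qvar (3 * n) *
      (qvar ^ (2 * n) * (2 - qvar ^ n) / (1 + qvar ^ n) ^ 2) *
      (qpoch (qvar ^ 2) (qvar ^ 4) ((3 * n - 1) div 4) ^ 2 /
       qpoch (qvar ^ 4) (qvar ^ 4) ((3 * n - 1) div 4) ^ 2)) (rhs n)"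
    unfolding rhs_qpoch[abs_def]
    by (intro evaluates_mult evaluates_divide evaluates_power evaluates_qpoch evaluates_qint evaluates_qvar
         evaluates_add evaluates_diff evaluates_1 evaluates_numeral_2)
       (use qpoch_nz[of _ 3] plus_nz in simp_all)
  have root: "\<zeta> ^ n = 1 \<and> \<zeta> \<noteq> 1" if "poly P \<zeta> = 0" for \<zeta>
  proof (cases "poly (cyclotomic n) \<zeta> = 0")
    case True
    then show ?thesis using cyclotomic_root[OF n(3) True] cyclotomic_root(2)[OF n(3) True, of 1] n(3) by auto
  next
    case False
    then show ?thesis using that qint_poly_root[OF assms(1)] by (auto simp: P_def)
  qed
  show ?thesis
    unfolding P_def[symmetric]
  proof (rule ratfun_congI[OF A B \<open>P \<noteq> 0\<close>])
    fix \<zeta> assume "poly P \<zeta> = 0"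
    then have \<zeta>: "\<zeta> ^ n = 1" "\<zeta> \<noteq> 1" using root by auto
    obtain d where d: "odd_root \<zeta> d" "d dvd n"
      using odd_root_exists[OF \<zeta> n(2)] .
    interpret odd_root \<zeta> d by (rule d(1))
    show "norm \<zeta> = 1" by (rule norm_root)
    show "(\<lambda>q. deformed_sum n q 0 0) \<in> O[disc_at \<zeta>](\<lambda>_. 1)"
      by (rule deformed_sum_bounded)
    show "rhs n \<in> O[disc_at \<zeta>](\<lambda>_. 1)"
      using rhs_tendsto_0[OF d(2)] by (intro bigoI_tendsto) auto
    have ord: "order \<zeta> P \<le> 1 + 4 * order \<zeta> (cyclotomic n)"
    proof -
      have "order \<zeta> (p ^ k) = k * order \<zeta> p" if "p \<noteq> 0" for p :: "complex poly" and k
        using that by (induction k) (simp_all add: order_mult)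
      then show ?thesis
        using order_qint_poly[OF assms(1) \<zeta>(1)] \<open>P \<noteq> 0\<close> cyclotomic_ne_0 by (simp add: P_def order_mult)
    qed
    \<comment> \<open>A root of \<open>cyclotomic n\<close> has exact order \<open>n\<close> and
      multiplicity at most five in \<open>P\<close>, matched by \<open>m = 4\<close> in the main
      estimate. Any other root is simple, so \<open>m = 0\<close>, the vanishing of both sides, is
      enough.\<close>
    show "\<exists>m. order \<zeta> P \<le> Suc m \<and> ((\<lambda>q. (deformed_sum n q 0 0 - rhs n q) / (q - \<zeta>) ^ m) \<longlongrightarrow> 0) (disc_at \<zeta>)"
    proof (cases "poly (cyclotomic n) \<zeta> = 0")
      case True
      then have "n dvd d" using cyclotomic_root(2)[OF n(3) True] root[of d] by simp
      then have "d = n" using d(2) by (simp add: dvd_antisym)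
      then show ?thesis
        using main_estimate[of "n div 4"] n(1) ord order_cyclotomic[OF n(3), of \<zeta>]
        by (intro exI[of _ 4]) simp
    next
      case False
      then have "order \<zeta> (cyclotomic n) = 0" by (rule order_0I)
      then show ?thesis
        using ord tendsto_diff[OF deformed_sum_tendsto_0[OF d(2)] rhs_tendsto_0[OF d(2)]]
        by (intro exI[of _ 0]) simp
    qed
  qed
qed

end
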